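(* Let $(E,A,B,C,D)$ be a descriptor system $E\dot x=Ax+B(u+w)$, $y=Cx+D(u+w)$, with $E,A$ of size $n\times n$, $B$ of size $n\times m$, $C$ of size $m\times n$, $D$ of size $m\times m$, $\det(sE-A)\not\equiv 0$, and transfer function $G(s)=C(sE-A)^{-1}B+D$. Suppose that the matrices $\begin{bmatrix}E & B\end{bmatrix}$ and $\begin{bmatrix}E\\ C\end{bmatrix}$ have maximum rank (i.e. rank $n$). Put $$\mathcal{E}=\begin{bmatrix}E&0\\0&0\end{bmatrix},\qquad \mathcal{A}=\begin{bmatrix}A&B\\C&D\end{bmatrix}$$ (both of size $(n+m)\times(n+m)$). Then there exist $m\times m$ matrices $K$ and $L$, with $I-KD$ non-singular, such that (1) the pair $(E,\,A+B(I-KD)^{-1}KC)$ is stable, and (2) $L(I-GK)^{-1}G$ is strictly positive real (SPR), if and only if the following conditions hold: (a) $\mathcal{A}$ is non-singular and the non-zero eigenvalues of $\mathcal{A}^{-1}\mathcal{E}$ have negative real part; (b) the index of zero as an eigenvalue of $\mathcal{A}^{-1}\mathcal{E}$ is at most two.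
   Context: Fix $\mathbb{F}\in\{\mathbb{R},\mathbb{C}\}$; all constant matrices have entries in $\mathbb{F}$. $M'$ denotes the conjugate transpose of $M$; for $M=M'$, $M>0$ means positive definite. Eigenvalues and stability of a pair: a number $\lambda\in\mathbb{C}$ is an eigenvalue of a pair $(E,F)$ of square matrices of the same size if there is a non-zero (complex) vector $v$ with $(\lambda E-F)v=0$. The pair $(E,F)$ is stable if every eigenvalue of $(E,F)$ has negative real part. Poles: $\lambda\in\mathbb{C}$ is a pole of a rational matrix function $H$ if $\lim_{s\to\lambda}H(s)$ does not exist (as a finite matrix). SPR: a square rational matrix function $H$ is strictly positive real if there is $\epsilon>0$ such that $H(s)+H(s)'>0$ for every $s\in\mathbb{C}$ with $\Re(s)\ge-\epsilon$ that is not a pole of $H$. The statement that $L(I-GK)^{-1}G$ is SPR includes that $I-GK$ is invertible as a rational matrix function. Index of zero: the index of zero as an eigenvalue of a square matrix $S$ is the smallest integer $k\ge0$ for which $\operatorname{rank}(S^{k+1})=\operatorname{rank}(S^k)$. *)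

theory Defs
  imports "HOL-Analysis.Analysis" "HOL-Computational_Algebra.Polynomial_Factorial"
    "HOL-Computational_Algebra.Field_as_Ring"
begin

section \<open>Constant matrices\<close>

text \<open>
  A matrix with \<open>r\<close> rows and \<open>c\<close> columns has type \<open>'a ^ 'c ^ 'r\<close>; the ground field is a set
  of complex numbers, either \<open>\<real>\<close> or \<open>UNIV\<close>, to which the entries of real or complex data belong.
\<close>

definition entries_in :: "'a set \<Rightarrow> 'a ^ 'c ^ 'r \<Rightarrow> bool" where
  "entries_in F M \<longleftrightarrow> (\<forall>i j. M $ i $ j \<in> F)"

definition row_block :: "'a ^ 'c ^ 'r \<Rightarrow> 'a ^ 'd ^ 'r \<Rightarrow> 'a ^ ('c + 'd) ^ 'r" where
  "row_block P Q = (\<chi> i j. case j of Inl j' \<Rightarrow> P $ i $ j' | Inr j' \<Rightarrow> Q $ i $ j')"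

definition col_block :: "'a ^ 'c ^ 'r \<Rightarrow> 'a ^ 'c ^ 's \<Rightarrow> 'a ^ 'c ^ ('r + 's)" where
  "col_block P R = (\<chi> i. case i of Inl i' \<Rightarrow> P $ i' | Inr i' \<Rightarrow> R $ i')"

definition four_block ::
  "'a ^ 'c ^ 'r \<Rightarrow> 'a ^ 'd ^ 'r \<Rightarrow> 'a ^ 'c ^ 's \<Rightarrow> 'a ^ 'd ^ 's \<Rightarrow> 'a ^ ('c + 'd) ^ ('r + 's)" where
  "four_block P Q R S = col_block (row_block P Q) (row_block R S)"

definition conj_transpose :: "complex ^ 'c ^ 'r \<Rightarrow> complex ^ 'r ^ 'c" where
  "conj_transpose M = map_matrix cnj (transpose M)"

text \<open>For Hermitian \<open>M\<close> the form \<open>v' M v\<close> is real, so that taking its real part loses nothing.\<close>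

definition pos_def :: "complex ^ 'k ^ 'k \<Rightarrow> bool" where
  "pos_def M \<longleftrightarrow> conj_transpose M = M \<and>
     (\<forall>v. v \<noteq> 0 \<longrightarrow> 0 < Re (\<Sum>i\<in>UNIV. cnj (v $ i) * (M *v v) $ i))"

text \<open>The multiplication \<open>*\<close> of type \<open>'a ^ 'k ^ 'k\<close>, and hence its \<open>^\<close>, is componentwise.\<close>

primrec mat_pow :: "'a::semiring_1 ^ 'k ^ 'k \<Rightarrow> nat \<Rightarrow> 'a ^ 'k ^ 'k" where
  "mat_pow S 0 = mat 1"
| "mat_pow S (Suc k) = S ** mat_pow S k"

definition index_of_zero :: "complex ^ 'k ^ 'k \<Rightarrow> nat" where
  "index_of_zero S = (LEAST k. rank (mat_pow S (k + 1)) = rank (mat_pow S k))"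

definition eigenvalue :: "complex ^ 'k ^ 'k \<Rightarrow> complex \<Rightarrow> bool" where
  "eigenvalue S \<mu> \<longleftrightarrow> (\<exists>v. v \<noteq> 0 \<and> S *v v = \<mu> *s v)"

definition pair_eigenvalue :: "complex ^ 'k ^ 'k \<Rightarrow> complex ^ 'k ^ 'k \<Rightarrow> complex \<Rightarrow> bool" where
  "pair_eigenvalue E F \<mu> \<longleftrightarrow> (\<exists>v. v \<noteq> 0 \<and> (map_matrix ((*) \<mu>) E - F) *v v = 0)"

definition stable_pair :: "complex ^ 'k ^ 'k \<Rightarrow> complex ^ 'k ^ 'k \<Rightarrow> bool" where
  "stable_pair E F \<longleftrightarrow> (\<forall>\<mu>. pair_eigenvalue E F \<mu> \<longrightarrow> Re \<mu> < 0)"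


section \<open>Rational matrix functions\<close>

text \<open>
  Rational matrix functions are matrices over the field \<open>complex poly fract\<close> of rational
  functions in \<open>s\<close>, so that \<open>det\<close>, \<open>invertible\<close> and \<open>matrix_inv\<close> apply to them.
\<close>

definition const_mat :: "complex ^ 'c ^ 'r \<Rightarrow> complex poly fract ^ 'c ^ 'r" where
  "const_mat M = map_matrix (\<lambda>c. to_fract [:c:]) M"

definition pencil :: "complex ^ 'k ^ 'k \<Rightarrow> complex ^ 'k ^ 'k \<Rightarrow> complex poly fract ^ 'k ^ 'k" where
  "pencil E A = map_matrix ((*) (to_fract [:0, 1:])) (const_mat E) - const_mat A"

definition transfer_function ::
  "complex ^ 'n ^ 'n \<Rightarrow> complex ^ 'n ^ 'n \<Rightarrow> complex ^ 'm ^ 'n \<Rightarrow> complex ^ 'n ^ 'p \<Rightarrow>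
   complex ^ 'm ^ 'p \<Rightarrow> complex poly fract ^ 'm ^ 'p" where
  "transfer_function E A B C D =
     const_mat C ** matrix_inv (pencil E A) ** const_mat B + const_mat D"

text \<open>
  Evaluation uses the representation of a rational function with coprime numerator and
  denominator; at a zero of the latter it yields 0 and has no significance.
\<close>

definition rat_eval :: "complex poly fract \<Rightarrow> complex \<Rightarrow> complex" where
  "rat_eval f s = poly (fst (quot_of_fract f)) s / poly (snd (quot_of_fract f)) s"

definition rmat_eval :: "complex poly fract ^ 'c ^ 'r \<Rightarrow> complex \<Rightarrow> complex ^ 'c ^ 'r" where
  "rmat_eval H s = map_matrix (\<lambda>f. rat_eval f s) H"

definition rmat_pole :: "complex poly fract ^ 'c ^ 'r \<Rightarrow> complex \<Rightarrow> bool" where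
  "rmat_pole H s \<longleftrightarrow> \<not> (\<exists>M. (rmat_eval H \<longlongrightarrow> M) (at s))"

definition SPR :: "complex poly fract ^ 'k ^ 'k \<Rightarrow> bool" where
  "SPR H \<longleftrightarrow> (\<exists>\<epsilon>>0. \<forall>s. Re s \<ge> - \<epsilon> \<longrightarrow> \<not> rmat_pole H s \<longrightarrow>
     pos_def (rmat_eval H s + conj_transpose (rmat_eval H s)))"

text \<open>Away from the poles, \<open>rmat_eval\<close> is the limit of the rational matrix function.\<close>

lemma rat_eval_tendsto:
  assumes "(rat_eval f \<longlongrightarrow> c) (at s)"
  shows "(rat_eval f \<longlongrightarrow> rat_eval f s) (at s)"
proof -
  define p where "p = fst (quot_of_fract f)"
  define q where "q = snd (quot_of_fract f)"
  have ev: "rat_eval f = (\<lambda>z. poly p z / poly q z)"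
    by (simp add: rat_eval_def p_def q_def fun_eq_iff)
  have q0: "q \<noteq> 0" and cop: "coprime p q"
    by (simp_all add: p_def q_def coprime_quot_of_fract)
  have "poly q s \<noteq> 0"
  proof
    assume qs: "poly q s = 0"
    have "eventually (\<lambda>z. poly q z \<noteq> 0) (at s)"
      using poly_roots_finite[OF q0] islimpt_finite[of "{z. poly q z = 0}" s]
      by (simp add: islimpt_iff_eventually)
    then have e: "eventually (\<lambda>z. rat_eval f z * poly q z = poly p z) (at s)"
      by eventually_elim (simp add: ev)
    have "((\<lambda>z. rat_eval f z * poly q z) \<longlongrightarrow> c * poly q s) (at s)"
      by (intro tendsto_mult assms isContD continuous_intros)
    with e have "(poly p \<longlongrightarrow> c * poly q s) (at s)"
      using tendsto_cong by fastforce
    moreover have "(poly p \<longlongrightarrow> poly p s) (at s)"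
      by (intro isContD continuous_intros)
    ultimately have "poly p s = 0"
      using qs tendsto_unique[OF at_neq_bot] by fastforce
    with qs have "[:- s, 1:] dvd p" "[:- s, 1:] dvd q"
      by (simp_all add: poly_eq_0_iff_dvd)
    with cop have "is_unit [:- s, 1:]"
      by (meson coprime_common_divisor)
    then show False
      by (simp add: is_unit_iff_degree)
  qed
  then show ?thesis
    unfolding ev by (intro isContD continuous_intros)
qed

lemma rmat_eval_tendsto:
  assumes "\<not> rmat_pole H s"
  shows "(rmat_eval H \<longlongrightarrow> rmat_eval H s) (at s)"
proof (intro vec_tendstoI)
  fix i j
  from assms obtain M where "(rmat_eval H \<longlongrightarrow> M) (at s)"
    by (auto simp: rmat_pole_def)
  then have "((\<lambda>z. rmat_eval H z $ i $ j) \<longlongrightarrow> M $ i $ j) (at s)"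
    by (intro tendsto_vec_nth)
  then have "(rat_eval (H $ i $ j) \<longlongrightarrow> M $ i $ j) (at s)"
    by (simp add: rmat_eval_def)
  from rat_eval_tendsto[OF this]
  show "((\<lambda>z. rmat_eval H z $ i $ j) \<longlongrightarrow> rmat_eval H s $ i $ j) (at s)"
    by (simp add: rmat_eval_def)
qed

end

theory Submission
  imports Defs
begin

text \<open>
  Write \<open>P(s) = s \<E> - \<A>\<close>. Its Schur complement gives \<open>G\<^sup>-\<^sup>1 = - [0 I] P\<^sup>-\<^sup>1 [0; I]\<close>, and
  \<open>L (I - G K)\<^sup>-\<^sup>1 G\<close> is SPR iff its inverse \<open>(G\<^sup>-\<^sup>1 - K) L\<^sup>-\<^sup>1\<close> is. To avoid inverting \<open>G\<close>, this is
  phrased as follows: if \<open>P(s) (x, u) = (0, - y)\<close> then \<open>u - K y\<close> is the external input that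
  produces the output \<open>y\<close>, and the condition is \<open>Re (L y)' (u - K y) > 0\<close> for \<open>y \<noteq> 0\<close>.

  Necessity: positivity makes \<open>P(s)\<close> non-singular on the closed right half-plane. A positive real
  rational function grows at most linearly, hence so does the lower right block of \<open>P\<^sup>-\<^sup>1\<close>; the rank
  conditions on \<open>[E B]\<close> and \<open>[E; C]\<close> propagate this to all of \<open>P\<^sup>-\<^sup>1\<close>, and linear growth of
  \<open>(s S - I)\<^sup>-\<^sup>1\<close> with \<open>S = \<A>\<^sup>-\<^sup>1 \<E>\<close> means that \<open>S\<^sup>3 v = 0\<close> implies \<open>S\<^sup>2 v = 0\<close>.

  Sufficiency: if \<open>S\<^sup>2 = Y S\<^sup>3\<close> then \<open>G\<^sup>-\<^sup>1 = s M + O(1)\<close> on \<open>Re s \<ge> - \<epsilon>\<close>. Choose \<open>X\<close> invertible with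
  \<open>M X\<close> positive semidefinite, \<open>L = X\<^sup>-\<^sup>1\<close> and \<open>K = - k L\<close> with \<open>k\<close> large; stability of the closed
  loop then follows from positivity.
\<close>

section \<open>Matrices over a field\<close>

lemma inverse_matrix_inv:
  assumes "invertible A"
  shows "A ** matrix_inv A = mat 1" "matrix_inv A ** A = mat 1"
proof -
  have "A ** matrix_inv A = mat 1 \<and> matrix_inv A ** A = mat 1"
    unfolding matrix_inv_def using assms[unfolded invertible_def] by (rule someI_ex)
  then show "A ** matrix_inv A = mat 1" "matrix_inv A ** A = mat 1" by auto
qed

lemma matrix_inv_cancel_vector:
  assumes "invertible A"
  shows "A *v (matrix_inv A *v x) = x" "matrix_inv A *v (A *v x) = x"
  using inverse_matrix_inv[OF assms] by (simp_all add: matrix_vector_mul_assoc)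

lemma matrix_inv_eqI:
  assumes "A ** B = mat 1" "B ** A = mat 1"
  shows "matrix_inv A = B"
proof -
  have "invertible A" using assms by (auto simp: invertible_def)
  then have "matrix_inv A ** (A ** B) = (matrix_inv A ** A) ** B" "matrix_inv A ** A = mat 1"
    by (auto simp: matrix_mul_assoc inverse_matrix_inv)
  then show ?thesis using assms by simp
qed

lemma invertible_iff_kernel:
  fixes A :: "'a::field ^ 'k ^ 'k"
  shows "invertible A \<longleftrightarrow> (\<forall>v. A *v v = 0 \<longrightarrow> v = 0)"
  by (simp add: invertible_left_inverse matrix_left_invertible_ker)

lemma uminus_matrix_vector: "(- A) *v x = - (A *v x)" "A *v (- x) = - (A *v x)"
  for A :: "'a::ring_1 ^ 'n ^ 'm"
  by (simp_all add: vec_eq_iff matrix_vector_mult_def sum_negf)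

lemma matrix_mul_diff_distrib:
  fixes A :: "'a::ring_1 ^ 'n ^ 'm"
  shows "A ** (B - C) = A ** B - A ** C" "(A - A') ** B = A ** B - A' ** B"
  by (simp_all add: vec_eq_iff matrix_matrix_mult_def sum_subtractf algebra_simps)

lemma matrix_mul_add_rdistrib: "(A + A') ** B = A ** B + A' ** B"
  by (simp add: vec_eq_iff matrix_matrix_mult_def sum.distrib distrib_right)

lemma smult_matrix_vector: "map_matrix ((*) c) M *v x = c *s (M *v x)"
  for M :: "'a::comm_semiring_1 ^ 'n ^ 'm"
  by (simp add: vec_eq_iff matrix_vector_mult_def sum_distrib_left mult_ac)

text \<open>A rank-one update along the kernel and the cokernel increases the rank, and an
  invertible inner inverse of the updated matrix is one of the original matrix as well.\<close>

lemma invertible_inner_inverse: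
  fixes M :: "'a::field ^ 'k ^ 'k"
  shows "\<exists>V. invertible V \<and> M ** V ** M = M"
proof (induction "vec.dim {x. M *v x = 0}" arbitrary: M rule: less_induct)
  case less
  show ?case
  proof (cases "invertible M")
    case True
    then show ?thesis
      by (metis inverse_matrix_inv invertible_def matrix_mul_lid)
  next
    case False
    then obtain u where u: "M *v u = 0" "u \<noteq> 0" by (auto simp: invertible_iff_kernel)
    from False have "\<not> (\<exists>B. B ** transpose M = mat 1)"
      by (metis invertible_right_inverse left_invertible_transpose transpose_transpose)
    then have "\<exists>w. transpose M *v w = 0 \<and> w \<noteq> 0" by (auto simp: matrix_left_invertible_ker)
    then obtain w where w: "w v* M = 0" "w \<noteq> 0" by auto
    obtain i where i: "u $ i \<noteq> 0" using u by (auto simp: vec_eq_iff)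
    obtain j where j: "w $ j \<noteq> 0" using w by (auto simp: vec_eq_iff)
    define R :: "'a ^ 'k ^ 'k" where "R = (\<chi> k l. if k = j \<and> l = i then 1 else 0)"
    \<comment> \<open>\<open>U\<close> and \<open>W\<close> carry the kernel vector \<open>u\<close>
      and the left kernel vector \<open>w\<close>, scaled so that \<open>R ** U = R\<close> and
      \<open>W ** R = R\<close>. As \<open>M ** U\<close> and \<open>W ** M\<close> vanish,
      \<open>N ** U\<close> and \<open>W ** N\<close> both equal \<open>R\<close>.\<close>
    define U :: "'a ^ 'k ^ 'k" where "U = (\<chi> k l. if l = i then u $ k / u $ i else 0)"
    define W :: "'a ^ 'k ^ 'k" where "W = (\<chi> k l. if k = j then w $ l / w $ j else 0)"
    define N where "N = M + R"
    have "(\<Sum>l\<in>UNIV. M $ k $ l * u $ l) = 0" for k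
      using u(1) by (simp add: vec_eq_iff matrix_vector_mult_def)
    then have "(\<Sum>l\<in>UNIV. M $ k $ l * u $ l / u $ i) = 0" for k
      by (simp flip: sum_divide_distrib)
    then have "(M ** U) $ k $ l = 0" for k l
      by (cases "l = i") (simp_all add: matrix_matrix_mult_def U_def)
    then have MU: "M ** U = 0" by (simp add: vec_eq_iff)
    have "(\<Sum>l\<in>UNIV. w $ l * M $ l $ k) = 0" for k
      using w(1) by (simp add: vec_eq_iff vector_matrix_mult_def mult.commute)
    then have "(\<Sum>l\<in>UNIV. w $ l / w $ j * M $ l $ k) = 0" for k
      by (simp flip: sum_divide_distrib)
    then have "(W ** M) $ l $ k = 0" for k l
      by (cases "l = j") (simp_all add: matrix_matrix_mult_def W_def)
    then have WM: "W ** M = 0" by (simp add: vec_eq_iff)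
    have "(R ** U) $ k $ l = R $ k $ l" for k l
      using i by (cases "k = j"; cases "l = i") (simp_all add: matrix_matrix_mult_def U_def R_def
          if_distrib[of "\<lambda>x. x * _"] if_distrib[of "\<lambda>x. _ * x"] if_distrib[of "\<lambda>x. x / _"] cong: if_cong)
    then have RU: "R ** U = R" by (simp add: vec_eq_iff)
    have "(W ** R) $ k $ l = R $ k $ l" for k l
      using j by (cases "k = j"; cases "l = i") (simp_all add: matrix_matrix_mult_def W_def R_def
          if_distrib[of "\<lambda>x. x * _"] if_distrib[of "\<lambda>x. _ * x"] if_distrib[of "\<lambda>x. x / _"] cong: if_cong)
    then have WR: "W ** R = R" by (simp add: vec_eq_iff)
    have NU: "N ** U = R" and WN: "W ** N = R"
      by (simp_all add: N_def matrix_mul_add_rdistrib matrix_add_ldistrib MU RU WM WR)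
    have "vec.dim {x. N *v x = 0} < vec.dim {x. M *v x = 0}"
    proof -
      have s: "vec.subspace {x. P *v x = 0}" for P :: "'a ^ 'k ^ 'k"
        by (auto simp: vec.subspace_def matrix_vector_right_distrib vector_scalar_commute)
      have sub: "{x. N *v x = 0} \<subseteq> {x. M *v x = 0}"
      proof safe
        fix x assume N0: "N *v x = 0"
        then have "R *v x = 0" by (simp flip: WN matrix_vector_mul_assoc)
        with N0 show "M *v x = 0" by (simp add: N_def matrix_vector_mult_add_rdistrib)
      qed
      have "R *v u = axis j (u $ i)"
        by (auto simp: R_def vec_eq_iff matrix_vector_mult_def axis_def if_distrib if_distribR
            cong: if_cong)
      then have "u \<notin> {x. N *v x = 0}"
        using u i by (auto simp: N_def matrix_vector_mult_add_rdistrib axis_eq_0_iff)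
      then have "{x. N *v x = 0} \<noteq> {x. M *v x = 0}" using u by auto
      then show ?thesis using sub s vec.subspace_dim_equal
        by (metis linorder_not_less)
    qed
    from less.hyps[OF this] obtain V where V: "invertible V" "N ** V ** N = N" by auto
    \<comment> \<open>Since \<open>R\<close> is both \<open>N ** U\<close> and
      \<open>W ** N\<close>, each product with the inner inverse of \<open>N\<close> collapses to
      \<open>R\<close>, and \<open>(N - R) ** V ** (N - R)\<close> expands to
      \<open>N - R - R + R\<close>.\<close>
    have NVR: "N ** V ** R = R" by (metis NU V(2) matrix_mul_assoc)
    have RVN: "R ** V ** N = R" by (metis WN V(2) matrix_mul_assoc)
    have RVR: "R ** V ** R = R" by (metis NVR WN WR matrix_mul_assoc)
    have "(N - R) ** V ** (N - R) = N - R"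
      by (simp add: matrix_mul_diff_distrib V NVR RVN RVR)
    then show ?thesis using V(1) by (auto simp: N_def)
  qed
qed

text \<open>\<^const>\<open>rank\<close> is the dimension of the span of the rows, which left multiplication can only
  shrink.\<close>

lemma span_rows_mult:
  fixes Y :: "'a::field ^ 'l ^ 'k" and M :: "'a ^ 'm ^ 'l"
  shows "vec.span (rows (Y ** M)) \<subseteq> vec.span (rows M)"
proof (rule vec.span_minimal[OF _ vec.subspace_span], rule subsetI)
  fix x assume "x \<in> rows (Y ** M)"
  then obtain i where "x = row i (Y ** M)" by (auto simp: rows_def)
  then have "x = (\<Sum>l\<in>UNIV. Y $ i $ l *s row l M)"
    by (simp add: row_def vec_eq_iff matrix_matrix_mult_def)
  moreover have "row l M \<in> vec.span (rows M)" for l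
    by (rule vec.span_base) (auto simp: rows_def)
  ultimately show "x \<in> vec.span (rows M)"
    by (auto intro!: vec.span_sum vec.span_scale)
qed

text \<open>Each row of \<open>M\<close> is a combination of the rows of \<open>N\<close>, that is,
  \<open>transpose N\<close> applied to a coefficient vector; these coefficient vectors are the rows
  of \<open>Y\<close>.\<close>

lemma row_span_factor:
  fixes M :: "'a::field ^ 'm ^ 'k" and N :: "'a ^ 'm ^ 'l"
  assumes "rows M \<subseteq> vec.span (rows N)"
  shows "\<exists>Y. M = Y ** N"
proof -
  have "\<exists>c. row i M = transpose N *v c" for i
  proof -
    have "row i M \<in> vec.span (columns (transpose N))" using assms by (auto simp: rows_def)
    also have "\<dots> = range ((*v) (transpose N))"
    proof (intro equalityI)
      show "vec.span (columns (transpose N)) \<subseteq> range ((*v) (transpose N))"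
      proof (rule vec.span_minimal)
        show "columns (transpose N) \<subseteq> range ((*v) (transpose N))"
        proof
          fix x assume "x \<in> columns (transpose N)"
          then obtain l where "x = column l (transpose N)" by (auto simp: columns_def)
          then have "x = transpose N *v axis l 1"
            by (simp add: vec_eq_iff column_def transpose_def matrix_vector_mult_def axis_def
                if_distrib cong: if_cong)
          then show "x \<in> range ((*v) (transpose N))" by blast
        qed
        show "vec.subspace (range ((*v) (transpose N)))"
          using vec.subspace_UNIV by (intro vec.subspace_image) 
      qed
      show "range ((*v) (transpose N)) \<subseteq> vec.span (columns (transpose N))"
        using matrix_vector_mult_in_columnspace_gen by blast
    qed
    finally show ?thesis by blast
  qed
  then obtain c where c: "row i M = transpose N *v c i" for i by metis
  then have "M = (\<chi> i. c i) ** N"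
    by (auto simp: vec_eq_iff row_def vector_matrix_mult_def matrix_matrix_mult_def mult.commute)
  then show ?thesis by blast
qed

text \<open>The row space of \<open>S ** M\<close> lies in that of \<open>M\<close>, so equal
  dimensions mean equal row spaces. The factor \<open>Y\<close> replaces a statement on ranks by an
  identity that can be multiplied and applied to vectors.\<close>

lemma rank_mult_eq_iff:
  fixes S :: "'a::field ^ 'k ^ 'k" and M :: "'a ^ 'm ^ 'k"
  shows "rank (S ** M) = rank M \<longleftrightarrow> (\<exists>Y. M = Y ** (S ** M))"
proof
  assume "rank (S ** M) = rank M"
  then have "vec.dim (vec.span (rows (S ** M))) \<ge> vec.dim (vec.span (rows M))"
    by (simp add: row_rank_def_gen)
  then have "vec.span (rows (S ** M)) = vec.span (rows M)"
    by (intro vec.subspace_dim_equal vec.subspace_span span_rows_mult)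
  then show "\<exists>Y. M = Y ** (S ** M)" by (intro row_span_factor) (auto intro: vec.span_base)
next
  assume "\<exists>Y. M = Y ** (S ** M)"
  then have "vec.span (rows M) \<subseteq> vec.span (rows (S ** M))" by (metis span_rows_mult)
  then show "rank (S ** M) = rank M"
    using span_rows_mult[of S M] by (simp add: row_rank_def_gen) (metis subset_antisym vec.dim_span)
qed

section \<open>Stabilising ranks of powers and the index of zero\<close>

lemma rank_mult_le:
  fixes S :: "'a::field ^ 'k ^ 'k" and M :: "'a ^ 'm ^ 'k"
  shows "rank (S ** M) \<le> rank M"
  using vec.dim_subset[OF span_rows_mult[of S M]] by (simp add: row_rank_def_gen)

lemma mat_pow_add: "mat_pow S (j + k) = mat_pow S j ** mat_pow S k"
  by (induction j) (simp_all add: matrix_mul_assoc)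

text \<open>The ranks cannot drop for ever, so the least exponent \<open>j\<close> is attained. From
  \<open>mat_pow S j = Y ** mat_pow S (Suc j)\<close>, right multiplication by powers of
  \<open>S\<close> gives the same identity, with the same \<open>Y\<close>, at every
  \<open>k \<ge> j\<close>.\<close>

lemma index_of_zero_le_iff:
  "index_of_zero S \<le> k \<longleftrightarrow> (\<exists>Y. mat_pow S k = Y ** mat_pow S (Suc k))"
proof
  assume le: "index_of_zero S \<le> k"
  define j where "j = index_of_zero S"
  have "\<exists>j. rank (mat_pow S (j + 1)) = rank (mat_pow S j)"
  proof (rule ccontr)
    assume "\<not> ?thesis"
    then have less: "rank (mat_pow S (Suc j)) < rank (mat_pow S j)" for j
      using rank_mult_le[of S "mat_pow S j"] by (simp add: le_neq_implies_less)
    \<comment> \<open>Each strict drop costs at least one, which is impossible once \<open>j\<close>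
      exceeds the initial rank.\<close>
    have "rank (mat_pow S j) + j \<le> rank (mat_pow S 0)" for j
      by (induction j) (use less in \<open>auto simp del: mat_pow.simps intro: le_trans[rotated] simp: Suc_leI\<close>)
    from this[of "Suc (rank (mat_pow S 0))"] show False by linarith
  qed
  then have "rank (mat_pow S (j + 1)) = rank (mat_pow S j)"
    unfolding j_def index_of_zero_def by (rule LeastI_ex)
  then obtain Y where Y: "mat_pow S j = Y ** mat_pow S (Suc j)" using rank_mult_eq_iff by force
  from le have "k = j + (k - j)" by (simp add: j_def)
  then have "mat_pow S k = Y ** mat_pow S (Suc k)"
    by (metis Y add_Suc mat_pow_add matrix_mul_assoc)
  then show "\<exists>Y. mat_pow S k = Y ** mat_pow S (Suc k)" ..
next
  assume "\<exists>Y. mat_pow S k = Y ** mat_pow S (Suc k)"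
  then show "index_of_zero S \<le> k"
    unfolding index_of_zero_def by (intro Least_le) (simp add: rank_mult_eq_iff)
qed

text \<open>With \<open>V\<close> an inner inverse of \<open>N\<close>, the vectors
  \<open>V *v (N *v v)\<close> and \<open>v\<close> differ by an element of the kernel of
  \<open>N\<close>, on which \<open>M\<close> vanishes; hence
  \<open>M = (M ** V) ** N\<close>.\<close>

lemma kernel_factor:
  fixes M N :: "'a::field ^ 'k ^ 'k"
  assumes "\<And>v. N *v v = 0 \<Longrightarrow> M *v v = 0"
  shows "\<exists>Y. M = Y ** N"
proof -
  obtain V where V: "N ** V ** N = N" using invertible_inner_inverse by blast
  have "N *v (V *v (N *v v) - v) = 0" for v
    by (simp add: matrix_vector_mult_diff_distrib V matrix_vector_mul_assoc matrix_mul_assoc)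
  from assms[OF this] have "M = M ** V ** N"
    by (simp add: matrix_eq matrix_vector_mult_diff_distrib matrix_vector_mul_assoc matrix_mul_assoc)
  then show ?thesis by blast
qed

section \<open>Matrices of full row or column rank\<close>

lemma full_row_rank_left_kernel:
  fixes M :: "'a::field ^ 'm ^ 'k"
  assumes "rank M = CARD('k)" "x v* M = 0"
  shows "x = 0"
proof (rule ccontr)
  assume "x \<noteq> 0"
  then obtain i where i: "x $ i \<noteq> 0" by (auto simp: vec_eq_iff)
  have "(\<Sum>k\<in>UNIV. x $ k *s row k M) = 0"
    using assms(2) by (simp add: vec_eq_iff row_def vector_matrix_mult_def mult.commute)
  then have "x $ i *s row i M = - (\<Sum>k\<in>UNIV - {i}. x $ k *s row k M)"
    by (simp add: sum.remove[of UNIV i] eq_neg_iff_add_eq_0)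
  then have "inverse (x $ i) *s (x $ i *s row i M) =
      inverse (x $ i) *s - (\<Sum>k\<in>UNIV - {i}. x $ k *s row k M)" by simp
  then have ri: "row i M = inverse (x $ i) *s - (\<Sum>k\<in>UNIV - {i}. x $ k *s row k M)"
    using i by (simp add: vector_smult_assoc)
  let ?T = "(\<lambda>k. row k M) ` (UNIV - {i})"
  have "row i M \<in> vec.span ?T"
    unfolding ri by (intro vec.span_scale vec.span_neg vec.span_sum vec.span_base) auto
  then have "rows M \<subseteq> vec.span ?T"
    by (auto simp: rows_def) (metis (mono_tags, lifting) DiffI UNIV_I image_eqI singletonD vec.span_base)
  then have "rank M \<le> card ?T"
    unfolding row_rank_def_gen by (rule vec.dim_le_card) simp
  also have "\<dots> \<le> card (UNIV - {i})" by (intro card_image_le) simp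
  also have "\<dots> < CARD('k)" by (intro psubset_card_mono) auto
  finally show False using assms(1) by simp
qed

lemma full_column_rank_kernel:
  fixes M :: "'a::field ^ 'k ^ 'm"
  assumes "rank M = CARD('k)" "M *v x = 0"
  shows "x = 0"
proof -
  have "vec.span (rows M) = UNIV"
  proof (rule vec.subspace_dim_equal[OF vec.subspace_span vec.subspace_UNIV])
    show "vec.dim (vec.span (rows M)) \<ge> vec.dim (UNIV :: ('a ^ 'k) set)"
      using assms(1) by (simp add: row_rank_def_gen vec_dim_card del: vec.dim_UNIV)
  qed simp
  then show ?thesis
    using assms(2) matrix_left_invertible_span_rows_gen matrix_left_invertible_ker by blast
qed

section \<open>Polynomial matrix functions\<close>

text \<open>A predicate on functions lets complex matrices depending on \<open>s\<close> be treated
  entry by entry, without passing to matrices over polynomials.\<close>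

definition polyfun :: "(complex \<Rightarrow> complex) \<Rightarrow> bool" where
  "polyfun f \<longleftrightarrow> (\<exists>p. \<forall>s. f s = poly p s)"

section \<open>Closure, zeros and limits of polynomial functions\<close>

lemma polyfun_const [intro, simp]: "polyfun (\<lambda>s. c)"
  unfolding polyfun_def by (rule exI[of _ "[:c:]"]) simp

lemma polyfun_id [intro, simp]: "polyfun (\<lambda>s. s)"
  unfolding polyfun_def by (rule exI[of _ "[:0, 1:]"]) simp

lemma polyfun_add [intro]: "polyfun f \<Longrightarrow> polyfun g \<Longrightarrow> polyfun (\<lambda>s. f s + g s)"
  unfolding polyfun_def by (metis poly_add)

lemma polyfun_diff [intro]: "polyfun f \<Longrightarrow> polyfun g \<Longrightarrow> polyfun (\<lambda>s. f s - g s)"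
  unfolding polyfun_def by (metis poly_diff)

lemma polyfun_mult [intro]: "polyfun f \<Longrightarrow> polyfun g \<Longrightarrow> polyfun (\<lambda>s. f s * g s)"
  unfolding polyfun_def by (metis poly_mult)

lemma polyfun_sum [intro]: "(\<And>i. i \<in> I \<Longrightarrow> polyfun (f i)) \<Longrightarrow> polyfun (\<lambda>s. \<Sum>i\<in>I. f i s)"
  by (induction I rule: infinite_finite_induct) auto

lemma polyfun_prod [intro]: "(\<And>i. i \<in> I \<Longrightarrow> polyfun (f i)) \<Longrightarrow> polyfun (\<lambda>s. \<Prod>i\<in>I. f i s)"
  by (induction I rule: infinite_finite_induct) auto

lemma polyfun_det:
  assumes "\<And>i j. polyfun (\<lambda>s. M s $ i $ j)"
  shows "polyfun (\<lambda>s. det (M s))"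
  unfolding det_def using assms by (intro polyfun_sum polyfun_mult polyfun_const polyfun_prod)

lemma polyfun_finite_zeros:
  assumes "polyfun f" "f a \<noteq> 0"
  shows "finite {s. f s = 0}"
proof -
  from assms(1) obtain p where p: "f = poly p" by (auto simp: polyfun_def)
  with assms(2) have "p \<noteq> 0" by auto
  then show ?thesis using poly_roots_finite p by blast
qed

lemma polyfun_tendsto: "polyfun f \<Longrightarrow> (f \<longlongrightarrow> f s) (at s)"
proof -
  assume "polyfun f"
  then obtain p where "f = poly p" by (auto simp: polyfun_def)
  then show ?thesis using isContD poly_isCont by metis
qed

text \<open>Finitely many zeros cannot cover a real ray. This supplies real parameters, beyond a
  prescribed bound, for which a determinant does not vanish.\<close>

lemma finite_real_avoid:
  assumes "polyfun f" "f a \<noteq> 0"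
  shows "\<exists>t::real. t > b \<and> f (of_real t) \<noteq> 0"
proof -
  have "finite ((of_real :: real \<Rightarrow> complex) -` {s. f s = 0})"
    using polyfun_finite_zeros[OF assms] by (intro finite_vimageI) (auto simp: inj_on_def)
  then have "infinite ({b<..} - (of_real :: real \<Rightarrow> complex) -` {s. f s = 0})"
    using infinite_Ioi[of b] by (metis Diff_infinite_finite)
  then have "{b<..} - (of_real :: real \<Rightarrow> complex) -` {s. f s = 0} \<noteq> {}" by (metis finite.emptyI)
  then show ?thesis by auto
qed

text \<open>Exhibits the entries of the inverse as quotients of determinants, hence as quotients of
  polynomials when the matrix depends polynomially on \<open>s\<close>; both continuity and growth
  of inverses rest on this.\<close>

lemma matrix_inv_cramer:
  fixes A :: "'a::field ^ 'k ^ 'k"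
  assumes "invertible A"
  shows "matrix_inv A $ k $ l = det (\<chi> i j. if j = k then axis l 1 $ i else A $ i $ j) / det A"
proof -
  have "A *v (matrix_inv A *v axis l 1) = axis l 1"
    using assms by (rule matrix_inv_cancel_vector)
  moreover have "det A \<noteq> 0" using assms invertible_det_nz by blast
  ultimately have "matrix_inv A *v axis l 1
      = (\<chi> k. det (\<chi> i j. if j = k then axis l 1 $ i else A $ i $ j) / det A)"
    using cramer[of A "matrix_inv A *v axis l 1" "axis l 1"] by simp
  moreover have "matrix_inv A $ k $ l = (matrix_inv A *v axis l 1) $ k"
    by (simp add: matrix_vector_mult_def axis_def if_distrib cong: if_cong)
  ultimately show ?thesis by simp
qed

section \<open>Real and complex entries\<close>

lemma RC_closed:
  assumes "F = \<real> \<or> F = (UNIV :: complex set)"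
  shows "0 \<in> F" "1 \<in> F" "a \<in> F \<Longrightarrow> - a \<in> F" "a \<in> F \<Longrightarrow> cnj a \<in> F" "of_real r \<in> F"
    "a \<in> F \<Longrightarrow> b \<in> F \<Longrightarrow> a + b \<in> F" "a \<in> F \<Longrightarrow> b \<in> F \<Longrightarrow> a - b \<in> F"
    "a \<in> F \<Longrightarrow> b \<in> F \<Longrightarrow> a * b \<in> F" "(\<And>i. i \<in> I \<Longrightarrow> f i \<in> F) \<Longrightarrow> sum f I \<in> F"
  using assms by (auto simp: Reals_cnj_iff intro: sum_in_Reals)

lemma entries_in_closed:
  assumes F: "F = \<real> \<or> F = (UNIV :: complex set)"
  shows "entries_in F M \<Longrightarrow> entries_in F N \<Longrightarrow> entries_in F (M ** N)"
    "entries_in F M' \<Longrightarrow> entries_in F N' \<Longrightarrow> entries_in F (M' + N')"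
    "entries_in F M' \<Longrightarrow> entries_in F N' \<Longrightarrow> entries_in F (M' - N')"
    "entries_in F M \<Longrightarrow> entries_in F (- M)"
    "entries_in F (mat 1 :: complex ^ 'k ^ 'k)" "entries_in F (0 :: complex ^ 'c ^ 'r)"
    "entries_in F M \<Longrightarrow> entries_in F (conj_transpose M)"
    "entries_in F M \<Longrightarrow> entries_in F (map_matrix ((*) (of_real r)) M)"
proof -
  show "entries_in F (M ** N)" if "entries_in F M" "entries_in F N"
    unfolding entries_in_def matrix_matrix_mult_def
    using that by (auto simp: entries_in_def intro!: RC_closed(9)[OF F] RC_closed(8)[OF F])
qed (use RC_closed(1-8)[OF F] in
  \<open>simp_all add: entries_in_def mat_def conj_transpose_def transpose_def\<close>)

lemma entries_in_four_block:
  assumes "entries_in F P" "entries_in F Q" "entries_in F R" "entries_in F S"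
  shows "entries_in F (four_block P Q R S)"
  using assms
  by (auto simp: entries_in_def four_block_def col_block_def row_block_def split: sum.splits)

section \<open>Descent of linear matrix equations to real entries\<close>

definition real_part_mat :: "complex ^ 'c ^ 'r \<Rightarrow> complex ^ 'c ^ 'r" where
  "real_part_mat M = map_matrix (\<lambda>z. of_real (Re z)) M"

definition imag_part_mat :: "complex ^ 'c ^ 'r \<Rightarrow> complex ^ 'c ^ 'r" where
  "imag_part_mat M = map_matrix (\<lambda>z. of_real (Im z)) M"

lemma entries_in_part_mat [simp]:
  "entries_in \<real> (real_part_mat M)" "entries_in \<real> (imag_part_mat M)"
  by (simp_all add: entries_in_def real_part_mat_def imag_part_mat_def)

lemma real_part_mat_id: "entries_in \<real> M \<Longrightarrow> real_part_mat M = M"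
  by (auto simp: entries_in_def real_part_mat_def vec_eq_iff complex_is_Real_iff complex_eq_iff)

lemma imag_part_mat_0: "entries_in \<real> M \<Longrightarrow> imag_part_mat M = 0"
  by (auto simp: entries_in_def imag_part_mat_def vec_eq_iff complex_is_Real_iff)


lemma real_part_mat_mult:
  assumes "entries_in \<real> N"
  shows "real_part_mat (M ** N) = real_part_mat M ** N" "imag_part_mat (M ** N) = imag_part_mat M ** N"
  using assms
  by (simp_all add: entries_in_def real_part_mat_def imag_part_mat_def vec_eq_iff complex_eq_iff
      matrix_matrix_mult_def complex_is_Real_iff)

lemma real_mult_part_mat:
  assumes "entries_in \<real> N"
  shows "real_part_mat (N ** M) = N ** real_part_mat M" "imag_part_mat (N ** M) = N ** imag_part_mat M"
  using assms
  by (simp_all add: entries_in_def real_part_mat_def imag_part_mat_def vec_eq_iff complex_eq_iff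
      matrix_matrix_mult_def complex_is_Real_iff)

text \<open>When \<open>M\<close> and \<open>N\<close> are real, taking real parts in
  \<open>M = Y ** N\<close> affects only \<open>Y\<close>, so the real part of \<open>Y\<close> is a
  factor as well.\<close>

lemma entries_in_left_factor:
  fixes F :: "complex set"
  assumes "F = \<real> \<or> F = UNIV" "entries_in F M" "entries_in F N" "M = Y ** N"
  shows "\<exists>Y. entries_in F Y \<and> M = Y ** N"
  using assms(1)
proof
  assume R: "F = \<real>"
  have "M = real_part_mat (Y ** N)" using assms R by (simp add: real_part_mat_id)
  also have "\<dots> = real_part_mat Y ** N" using assms R by (simp add: real_part_mat_mult)
  finally show ?thesis using R by (intro exI[of _ "real_part_mat Y"]) simp
next
  assume "F = UNIV"
  then show ?thesis using assms(4) by (auto simp: entries_in_def)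
qed

lemma entries_in_matrix_inv:
  fixes M :: "complex ^ 'k ^ 'k"
  assumes F: "F = \<real> \<or> F = UNIV" and "entries_in F M" "invertible M"
  shows "entries_in F (matrix_inv M)"
proof -
  have "mat 1 = matrix_inv M ** M" using assms by (simp add: inverse_matrix_inv)
  from entries_in_left_factor[OF F entries_in_closed(5)[OF F] assms(2), OF this]
  obtain Y where Y: "entries_in F Y" "mat 1 = Y ** M" by auto
  then have "M ** Y = mat 1" by (subst matrix_left_right_inverse) (rule sym)
  then have "matrix_inv M = Y" using Y(2) by (intro matrix_inv_eqI) simp_all
  then show ?thesis using Y(1) by simp
qed

text \<open>For real \<open>M\<close> both parts of a complex inner inverse solve a linear equation over the reals,
  and a real combination of them is invertible because their combination with \<open>\<i>\<close> is.\<close>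

lemma entries_in_inner_inverse:
  fixes M :: "complex ^ 'k ^ 'k"
  assumes F: "F = \<real> \<or> F = UNIV" and M: "entries_in F M"
  shows "\<exists>V. entries_in F V \<and> invertible V \<and> M ** V ** M = M"
  using F
proof
  assume R: "F = \<real>"
  obtain V where V: "invertible V" "M ** V ** M = M" using invertible_inner_inverse by blast
  define f where "f = (\<lambda>z. det (real_part_mat V + map_matrix ((*) z) (imag_part_mat V)))"
  have "polyfun f" unfolding f_def
    by (intro polyfun_det, simp) (intro polyfun_add polyfun_mult polyfun_const polyfun_id)
  moreover have "real_part_mat V + map_matrix ((*) \<i>) (imag_part_mat V) = V"
    by (simp add: vec_eq_iff complex_eq_iff real_part_mat_def imag_part_mat_def)
  then have "f \<i> \<noteq> 0" using V(1) invertible_det_nz by (auto simp: f_def)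
  ultimately obtain t :: real where t: "f (of_real t) \<noteq> 0" using finite_real_avoid by blast
  define V' where "V' = real_part_mat V + map_matrix ((*) (of_real t)) (imag_part_mat V)"
  have M': "entries_in \<real> M" using M R by simp
  have "M ** real_part_mat V ** M = M" "M ** imag_part_mat V ** M = 0"
    using real_mult_part_mat[OF M', of V] real_part_mat_mult[OF M', of "M ** V"]
      real_part_mat_id[OF M'] imag_part_mat_0[OF M'] V(2) by auto
  moreover have "M ** map_matrix ((*) c) N ** M = map_matrix ((*) c) (M ** N ** M)" for c N
    by (simp add: vec_eq_iff matrix_matrix_mult_def sum_distrib_left mult_ac)
  ultimately have "M ** V' ** M = M"
    by (simp add: V'_def matrix_add_ldistrib matrix_mul_add_rdistrib) (simp add: vec_eq_iff)
  moreover have "invertible V'" using t by (simp add: f_def V'_def invertible_det_nz)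
  moreover have "entries_in \<real> V'"
    unfolding V'_def by (intro entries_in_closed) auto
  ultimately show ?thesis using R by blast
next
  assume "F = UNIV"
  then show ?thesis using invertible_inner_inverse by (auto simp: entries_in_def)
qed

section \<open>Evaluation of rational matrix functions\<close>

definition regular_at :: "complex poly fract \<Rightarrow> complex \<Rightarrow> bool" where
  "regular_at f s \<longleftrightarrow> poly (snd (quot_of_fract f)) s \<noteq> 0"

lemma finite_not_regular: "finite {s. \<not> regular_at f s}"
  using poly_roots_finite[of "snd (quot_of_fract f)"] by (simp add: regular_at_def)

lemma fract_times_denominator:
  "f * to_fract (snd (quot_of_fract f)) = to_fract (fst (quot_of_fract f))"
proof -
  have "f = to_fract (fst (quot_of_fract f)) / to_fract (snd (quot_of_fract f))"
    by (metis to_fract_quot_of_fract Fract_conv_to_fract Fract_quot_of_fract)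
  moreover have "to_fract (snd (quot_of_fract f)) \<noteq> 0" by simp
  ultimately show ?thesis by (metis nonzero_eq_divide_eq)
qed

text \<open>Evaluation may use any representation whose denominator is non-zero at \<open>s\<close>:
  by coprimality the reduced denominator divides \<open>q\<close>, so it is non-zero at
  \<open>s\<close> too.\<close>

lemma rat_evalI:
  assumes "f * to_fract q = to_fract p" "poly q s \<noteq> 0"
  shows "regular_at f s" "rat_eval f s = poly p s / poly q s"
proof -
  define a where "a = fst (quot_of_fract f)"
  define b where "b = snd (quot_of_fract f)"
  have "to_fract (a * q) = (f * to_fract b) * to_fract q"
    by (simp add: a_def b_def fract_times_denominator)
  also have "\<dots> = (f * to_fract q) * to_fract b" by (simp only: mult_ac)
  also have "\<dots> = to_fract (p * b)" by (simp add: assms(1))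
  finally have "to_fract (a * q) = to_fract (p * b)" .
  then have eq: "a * q = p * b" by (simp only: to_fract_eq_iff)
  have "coprime a b" by (simp add: a_def b_def coprime_quot_of_fract)
  then have "b dvd q" using eq by (metis coprime_commute coprime_dvd_mult_right_iff dvd_triv_right)
  then have b: "poly b s \<noteq> 0" using assms(2) by (metis dvdE mult_zero_left poly_mult)
  then show "regular_at f s" by (simp add: regular_at_def b_def)
  have "poly a s * poly q s = poly p s * poly b s" using eq by (metis poly_mult)
  then show "rat_eval f s = poly p s / poly q s"
    using b assms(2) by (simp add: rat_eval_def a_def b_def frac_eq_eq)
qed

lemma rat_eval_arith:
  assumes "regular_at f s" "regular_at g s"
  shows "regular_at (f + g) s" "rat_eval (f + g) s = rat_eval f s + rat_eval g s"
    "regular_at (f - g) s" "rat_eval (f - g) s = rat_eval f s - rat_eval g s"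
    "regular_at (f * g) s" "rat_eval (f * g) s = rat_eval f s * rat_eval g s"
proof -
  define a where "a = fst (quot_of_fract f)"
  define b where "b = snd (quot_of_fract f)"
  define c where "c = fst (quot_of_fract g)"
  define d where "d = snd (quot_of_fract g)"
  have f: "f * to_fract b = to_fract a" and g: "g * to_fract d = to_fract c"
    by (simp_all add: a_def b_def c_def d_def fract_times_denominator)
  have nz: "poly b s \<noteq> 0" "poly d s \<noteq> 0" using assms by (simp_all add: regular_at_def b_def d_def)
  then have nz': "poly (b * d) s \<noteq> 0" by simp
  have ev: "rat_eval f s = poly a s / poly b s" "rat_eval g s = poly c s / poly d s"
    by (simp_all add: rat_eval_def a_def b_def c_def d_def)
  have "(f + g) * to_fract (b * d) = (f * to_fract b) * to_fract d + (g * to_fract d) * to_fract b"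
    unfolding to_fract_mult by (simp only: algebra_simps)
  then have "(f + g) * to_fract (b * d) = to_fract (a * d + c * b)" by (simp add: f g)
  from rat_evalI[OF this nz'] show "regular_at (f + g) s" "rat_eval (f + g) s = rat_eval f s + rat_eval g s"
    using nz by (simp_all add: ev add_frac_eq)
  have "(f - g) * to_fract (b * d) = (f * to_fract b) * to_fract d - (g * to_fract d) * to_fract b"
    unfolding to_fract_mult by (simp only: algebra_simps)
  then have "(f - g) * to_fract (b * d) = to_fract (a * d - c * b)" by (simp add: f g)
  from rat_evalI[OF this nz'] show "regular_at (f - g) s" "rat_eval (f - g) s = rat_eval f s - rat_eval g s"
    using nz by (simp_all add: ev diff_frac_eq)
  have "(f * g) * to_fract (b * d) = (f * to_fract b) * (g * to_fract d)"
    unfolding to_fract_mult by (simp only: algebra_simps)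
  then have "(f * g) * to_fract (b * d) = to_fract (a * c)" by (simp add: f g)
  from rat_evalI[OF this nz'] show "regular_at (f * g) s" "rat_eval (f * g) s = rat_eval f s * rat_eval g s"
    by (simp_all add: ev)
qed

lemma rat_eval_to_fract [simp]: "regular_at (to_fract p) s" "rat_eval (to_fract p) s = poly p s"
  by (simp_all add: regular_at_def rat_eval_def)

lemma rat_eval_0_1 [simp]: "regular_at 0 s" "rat_eval 0 s = 0" "regular_at 1 s" "rat_eval 1 s = 1"
  by (simp_all add: regular_at_def rat_eval_def)

lemma rat_eval_sum:
  assumes "\<And>i. i \<in> I \<Longrightarrow> regular_at (f i) s"
  shows "regular_at (sum f I) s \<and> rat_eval (sum f I) s = (\<Sum>i\<in>I. rat_eval (f i) s)"
  using assms by (induction I rule: infinite_finite_induct) (auto simp: rat_eval_arith)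

definition mat_regular_at :: "complex poly fract ^ 'c ^ 'r \<Rightarrow> complex \<Rightarrow> bool" where
  "mat_regular_at M s \<longleftrightarrow> (\<forall>i j. regular_at (M $ i $ j) s)"

lemma eventually_mat_regular: "eventually (mat_regular_at M) (at s)"
proof -
  have "eventually (\<lambda>z. regular_at f z) (at s)" for f
    using finite_not_regular[of f] islimpt_finite[of "{z. \<not> regular_at f z}" s]
    by (simp add: islimpt_iff_eventually)
  then show ?thesis by (simp add: mat_regular_at_def[abs_def] eventually_all_finite)
qed

lemma rmat_eval_mult:
  assumes "mat_regular_at M s" "mat_regular_at N s"
  shows "mat_regular_at (M ** N) s" "rmat_eval (M ** N) s = rmat_eval M s ** rmat_eval N s"
  using assms
  by (simp_all add: mat_regular_at_def rmat_eval_def matrix_matrix_mult_def vec_eq_iff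
      rat_eval_sum rat_eval_arith)

lemma rmat_eval_arith:
  assumes "mat_regular_at M s" "mat_regular_at N s"
  shows "mat_regular_at (M + N) s" "rmat_eval (M + N) s = rmat_eval M s + rmat_eval N s"
    "mat_regular_at (M - N) s" "rmat_eval (M - N) s = rmat_eval M s - rmat_eval N s"
  using assms
  by (simp_all add: mat_regular_at_def rmat_eval_def vec_eq_iff rat_eval_arith)

lemma rmat_eval_const [simp]: "mat_regular_at (const_mat M) s" "rmat_eval (const_mat M) s = M"
  by (simp_all add: mat_regular_at_def rmat_eval_def const_mat_def vec_eq_iff)

lemma rmat_eval_mat_1 [simp]: "mat_regular_at (mat 1) s" "rmat_eval (mat 1) s = mat 1"
  by (simp_all add: mat_regular_at_def rmat_eval_def mat_def vec_eq_iff)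

lemma rmat_eval_pencil [simp]:
  "mat_regular_at (pencil E A) s" "rmat_eval (pencil E A) s = map_matrix ((*) s) E - A"
  by (simp_all add: mat_regular_at_def rmat_eval_def pencil_def const_mat_def vec_eq_iff rat_eval_arith)

lemma rmat_eval_matrix_inv:
  assumes "invertible M" "mat_regular_at M s" "mat_regular_at (matrix_inv M) s"
  shows "rmat_eval M s ** rmat_eval (matrix_inv M) s = mat 1"
    "rmat_eval (matrix_inv M) s ** rmat_eval M s = mat 1"
  unfolding rmat_eval_mult(2)[OF assms(2,3), symmetric] rmat_eval_mult(2)[OF assms(3,2), symmetric]
  by (simp_all add: inverse_matrix_inv[OF assms(1)])

section \<open>Descriptor systems\<close>

definition joinv :: "'a ^ 'n \<Rightarrow> 'a ^ 'm \<Rightarrow> 'a ^ ('n + 'm)" where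
  "joinv x u = (\<chi> i. case i of Inl a \<Rightarrow> x $ a | Inr b \<Rightarrow> u $ b)"

lemma joinv_nth [simp]: "joinv x u $ Inl a = x $ a" "joinv x u $ Inr b = u $ b"
  by (simp_all add: joinv_def)

lemma joinv_cases: obtains x u where "z = joinv x u"
proof
  show "z = joinv (\<chi> a. z $ Inl a) (\<chi> b. z $ Inr b)"
    by (simp add: joinv_def vec_eq_iff split: sum.splits)
qed

lemma joinv_eq_iff [simp]: "joinv x u = joinv y w \<longleftrightarrow> x = y \<and> u = w"
  by (metis joinv_nth vec_eq_iff)

lemma joinv_0: "joinv 0 0 = 0"
  by (simp add: joinv_def vec_eq_iff split: sum.splits)

lemma joinv_eq_0_iff [simp]: "joinv x u = 0 \<longleftrightarrow> x = 0 \<and> u = 0"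
  by (metis joinv_0 joinv_eq_iff)

lemma sum_UNIV_sum_type:
  "(\<Sum>i\<in>(UNIV :: ('a::finite + 'b::finite) set). f i) = (\<Sum>a\<in>UNIV. f (Inl a)) + (\<Sum>b\<in>UNIV. f (Inr b))"
  by (simp add: sum.Plus flip: UNIV_Plus_UNIV)

lemma block_mult_joinv:
  "four_block P Q R S *v joinv x u = joinv (P *v x + Q *v u) (R *v x + S *v u)"
  "row_block P Q *v joinv x u = P *v x + Q *v u"
  "col_block P R *v x = joinv (P *v x) (R *v x)"
  by (auto simp: vec_eq_iff matrix_vector_mult_def sum_UNIV_sum_type four_block_def col_block_def
      row_block_def joinv_def split: sum.splits)

lemma row_block_left_mult: "w v* row_block P Q = joinv (w v* P) (w v* Q)"
  by (auto simp: vec_eq_iff vector_matrix_mult_def row_block_def joinv_def split: sum.splits)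

text \<open>The pencil \<open>s \<E> - \<A>\<close> in block form. With these signs the lower
  component of its value at \<open>(x, u)\<close> is minus the output.\<close>

definition rosenbrock ::
  "complex ^ 'n ^ 'n \<Rightarrow> complex ^ 'n ^ 'n \<Rightarrow> complex ^ 'm ^ 'n \<Rightarrow> complex ^ 'n ^ 'm \<Rightarrow>
   complex ^ 'm ^ 'm \<Rightarrow> complex \<Rightarrow> complex ^ ('n + 'm) ^ ('n + 'm)" where
  "rosenbrock E A B C D s = four_block (map_matrix ((*) s) E - A) (- B) (- C) (- D)"

text \<open>Here \<open>u\<close> is the total input, so the lower component at
  \<open>(x, u)\<close> is the external input \<open>u - K y\<close>. Keeping \<open>u\<close> as an
  unknown avoids the inverses of \<open>I - K D\<close> and \<open>I - G K\<close>.\<close>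

definition feedback_matrix ::
  "complex ^ 'n ^ 'n \<Rightarrow> complex ^ 'n ^ 'n \<Rightarrow> complex ^ 'm ^ 'n \<Rightarrow> complex ^ 'n ^ 'm \<Rightarrow>
   complex ^ 'm ^ 'm \<Rightarrow> complex ^ 'm ^ 'm \<Rightarrow> complex \<Rightarrow> complex ^ ('n + 'm) ^ ('n + 'm)" where
  "feedback_matrix E A B C D K s =
     four_block (map_matrix ((*) s) E - A) (- B) (- (K ** C)) (mat 1 - K ** D)"

text \<open>The value of \<open>(I - G K)\<^sup>-\<^sup>1 G\<close>, obtained by solving for
  \<open>(x, u)\<close> under a given external input and reading off the output. It makes sense even
  where \<open>s E - A\<close> is singular, as long as the feedback matrix is invertible.\<close>

definition closed_loop ::
  "complex ^ 'n ^ 'n \<Rightarrow> complex ^ 'n ^ 'n \<Rightarrow> complex ^ 'm ^ 'n \<Rightarrow> complex ^ 'n ^ 'm \<Rightarrow>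
   complex ^ 'm ^ 'm \<Rightarrow> complex ^ 'm ^ 'm \<Rightarrow> complex \<Rightarrow> complex ^ 'm ^ 'm" where
  "closed_loop E A B C D K s =
     row_block C D ** matrix_inv (feedback_matrix E A B C D K s) ** col_block 0 (mat 1)"

lemma rosenbrock_joinv:
  "rosenbrock E A B C D s *v joinv x u =
     joinv (s *s (E *v x) - A *v x - B *v u) (- (C *v x + D *v u))"
  by (simp add: rosenbrock_def block_mult_joinv matrix_vector_mult_diff_rdistrib
      smult_matrix_vector uminus_matrix_vector)

lemma feedback_joinv:
  "feedback_matrix E A B C D K s *v joinv x u =
     joinv (s *s (E *v x) - A *v x - B *v u) (u - K *v (C *v x + D *v u))"
  by (simp add: feedback_matrix_def block_mult_joinv matrix_vector_mult_diff_rdistrib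
      smult_matrix_vector uminus_matrix_vector matrix_vector_right_distrib matrix_vector_mul_assoc)

lemma polyfun_rosenbrock: "polyfun (\<lambda>s. rosenbrock E A B C D s $ i $ j)"
  by (cases i; cases j)
    (auto simp: rosenbrock_def four_block_def col_block_def row_block_def
      intro!: polyfun_diff polyfun_mult polyfun_const)

lemma polyfun_feedback: "polyfun (\<lambda>s. feedback_matrix E A B C D K s $ i $ j)"
  by (cases i; cases j)
    (auto simp: feedback_matrix_def four_block_def col_block_def row_block_def
      intro!: polyfun_diff polyfun_mult polyfun_const)

section \<open>Continuity of the closed loop and its relation to the transfer function\<close>

lemma tendsto_matrix_mult:
  fixes f :: "'x \<Rightarrow> complex ^ 'b ^ 'a" and g :: "'x \<Rightarrow> complex ^ 'c ^ 'b"
  assumes "(f \<longlongrightarrow> M) F" "(g \<longlongrightarrow> N) F"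
  shows "((\<lambda>s. f s ** g s) \<longlongrightarrow> M ** N) F"
  unfolding matrix_matrix_mult_def
  by (intro tendsto_vec_lambda tendsto_sum tendsto_mult tendsto_vec_nth assms)

lemma eventually_invertible:
  fixes M :: "complex \<Rightarrow> complex ^ 'k ^ 'k"
  assumes "\<And>i j. polyfun (\<lambda>s. M s $ i $ j)" "invertible (M a)"
  shows "eventually (\<lambda>s. invertible (M s)) (at a)"
proof -
  have "((\<lambda>s. det (M s)) \<longlongrightarrow> det (M a)) (at a)" by (intro polyfun_tendsto polyfun_det assms)
  moreover have "det (M a) \<noteq> 0" using assms(2) invertible_det_nz by blast
  ultimately have "eventually (\<lambda>s. det (M s) \<noteq> 0) (at a)" by (rule tendsto_imp_eventually_ne)
  then show ?thesis by (simp add: invertible_det_nz)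
qed

lemma tendsto_matrix_inv:
  fixes M :: "complex \<Rightarrow> complex ^ 'k ^ 'k"
  assumes M: "\<And>i j. polyfun (\<lambda>s. M s $ i $ j)" and "invertible (M a)"
  shows "((\<lambda>s. matrix_inv (M s)) \<longlongrightarrow> matrix_inv (M a)) (at a)"
proof (intro vec_tendstoI)
  fix k l
  define N :: "complex \<Rightarrow> complex ^ 'k ^ 'k"
    where "N = (\<lambda>s. \<chi> i j. if j = k then axis l 1 $ i else M s $ i $ j)"
  have N: "polyfun (\<lambda>s. N s $ i $ j)" for i j
    using M by (cases "j = k") (simp_all add: N_def)
  have nz: "det (M a) \<noteq> 0" using assms(2) invertible_det_nz by blast
  have "((\<lambda>s. det (N s) / det (M s)) \<longlongrightarrow> det (N a) / det (M a)) (at a)"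
    by (intro tendsto_divide polyfun_tendsto[of "\<lambda>s. det (N s)"] polyfun_tendsto[of "\<lambda>s. det (M s)"]
        polyfun_det M N nz)
  moreover have "eventually (\<lambda>s. det (N s) / det (M s) = matrix_inv (M s) $ k $ l) (at a)"
    using eventually_invertible[of M a] assms
    by (auto elim!: eventually_mono simp: matrix_inv_cramer N_def)
  moreover have "det (N a) / det (M a) = matrix_inv (M a) $ k $ l"
    using assms by (simp add: matrix_inv_cramer N_def)
  ultimately show "((\<lambda>s. matrix_inv (M s) $ k $ l) \<longlongrightarrow> matrix_inv (M a) $ k $ l) (at a)"
    using Lim_transform_eventually by fastforce
qed

lemma closed_loop_tendsto:
  assumes "invertible (feedback_matrix E A B C D K a)"
  shows "(closed_loop E A B C D K \<longlongrightarrow> closed_loop E A B C D K a) (at a)"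
  unfolding closed_loop_def[abs_def]
  by (intro tendsto_matrix_mult tendsto_const tendsto_matrix_inv polyfun_feedback assms)

lemma closed_loop_vector:
  assumes "feedback_matrix E A B C D K s *v joinv x u = joinv 0 w"
    and "invertible (feedback_matrix E A B C D K s)"
  shows "closed_loop E A B C D K s *v w = C *v x + D *v u"
proof -
  have "matrix_inv (feedback_matrix E A B C D K s) *v joinv 0 w = joinv x u"
    using matrix_inv_cancel_vector(2)[OF assms(2), of "joinv x u"] assms(1) by simp
  then have "row_block C D *v (matrix_inv (feedback_matrix E A B C D K s) *v joinv 0 w) = C *v x + D *v u"
    by (simp add: block_mult_joinv)
  then show ?thesis
    by (simp add: closed_loop_def block_mult_joinv flip: matrix_vector_mul_assoc)
qed

text \<open>At points near \<open>a\<close> where the rational inverses are regular,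
  \<open>x = (s E - A)\<^sup>-\<^sup>1 B u\<close>, \<open>y = G u\<close> and
  \<open>u = w + K y\<close> give \<open>(I - G K) y = G w\<close>, so both sides agree there. The
  point \<open>a\<close> itself, where \<open>s E - A\<close> may be singular, is reached by
  continuity of the closed loop, which also shows that it is not a pole.\<close>

lemma closed_loop_transfer:
  fixes E A :: "complex ^ 'n ^ 'n" and B :: "complex ^ 'm ^ 'n" and C :: "complex ^ 'n ^ 'm"
    and D K L :: "complex ^ 'm ^ 'm"
  defines "G \<equiv> transfer_function E A B C D"
  defines "H \<equiv> const_mat L ** matrix_inv (mat 1 - G ** const_mat K) ** G"
  assumes reg: "det (pencil E A) \<noteq> 0" and inv: "invertible (mat 1 - G ** const_mat K)"
    and fb: "invertible (feedback_matrix E A B C D K a)"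
  shows "\<not> rmat_pole H a \<and> rmat_eval H a = L ** closed_loop E A B C D K a"
proof -
  define I where "I = matrix_inv (mat 1 - G ** const_mat K)"
  define R where "R = matrix_inv (pencil E A)"
  have pinv: "invertible (pencil E A)" using reg invertible_det_nz by blast
  have "eventually (\<lambda>s. rmat_eval H s = L ** closed_loop E A B C D K s) (at a)"
    using eventually_mat_regular[of I a] eventually_mat_regular[of R a]
      eventually_invertible[OF polyfun_feedback fb]
  proof eventually_elim
    case (elim s)
    define Rs where "Rs = rmat_eval R s"
    define Gs where "Gs = C ** Rs ** B + D"
    define Is where "Is = rmat_eval I s"
    have Rs: "(map_matrix ((*) s) E - A) ** Rs = mat 1" "Rs ** (map_matrix ((*) s) E - A) = mat 1"
      using rmat_eval_matrix_inv[OF pinv, of s] elim by (simp_all add: R_def Rs_def)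
    have Gs: "mat_regular_at G s" "rmat_eval G s = Gs"
      using elim by (simp_all add: G_def transfer_function_def Gs_def Rs_def R_def
          rmat_eval_arith rmat_eval_mult)
    have m: "mat_regular_at (mat 1 - G ** const_mat K) s"
      "rmat_eval (mat 1 - G ** const_mat K) s = mat 1 - Gs ** K"
      using Gs by (simp_all add: rmat_eval_arith rmat_eval_mult)
    have Is: "Is ** (mat 1 - Gs ** K) = mat 1"
      using rmat_eval_matrix_inv(2)[OF inv m(1)] elim m by (simp add: I_def Is_def)
    have H: "rmat_eval H s = L ** Is ** Gs"
      using Gs elim by (simp add: H_def Is_def rmat_eval_mult I_def[symmetric])
    have "closed_loop E A B C D K s *v w = (Is ** Gs) *v w" for w
    proof -
      obtain x u where xu: "matrix_inv (feedback_matrix E A B C D K s) *v joinv 0 w = joinv x u"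
        by (rule joinv_cases)
      then have fxu: "feedback_matrix E A B C D K s *v joinv x u = joinv 0 w"
        using matrix_inv_cancel_vector(1)[OF elim(3), of "joinv 0 w"] by simp
      define y where "y = C *v x + D *v u"
      have eqs: "s *s (E *v x) - A *v x = B *v u" "u = w + K *v y"
        using fxu by (simp_all add: feedback_joinv y_def algebra_simps)
      have "x = Rs *v (B *v u)"
      proof -
        have "Rs *v (B *v u) = Rs *v ((map_matrix ((*) s) E - A) *v x)"
          by (simp add: matrix_vector_mult_diff_rdistrib smult_matrix_vector eqs(1))
        then show ?thesis by (simp add: matrix_vector_mul_assoc Rs(2))
      qed
      then have "y = Gs *v u"
        by (simp add: y_def Gs_def matrix_vector_mult_add_rdistrib matrix_vector_mul_assoc matrix_mul_assoc)
      then have "y = Gs *v w + Gs *v (K *v y)"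
        by (simp only: eqs(2) matrix_vector_right_distrib)
      then have "(mat 1 - Gs ** K) *v y = Gs *v w"
        unfolding matrix_vector_mult_diff_rdistrib
        by (simp flip: matrix_vector_mul_assoc) (metis add_diff_cancel_right')
      then have "Is *v (Gs *v w) = (Is ** (mat 1 - Gs ** K)) *v y"
        by (simp flip: matrix_vector_mul_assoc)
      then have "(Is ** Gs) *v w = y" by (simp add: Is matrix_vector_mul_assoc)
      then show ?thesis using closed_loop_vector[OF fxu elim(3)] by (simp add: y_def)
    qed
    then have "closed_loop E A B C D K s = Is ** Gs" by (simp add: matrix_eq)
    then show ?case by (simp add: H matrix_mul_assoc)
  qed
  then have "eventually (\<lambda>s. L ** closed_loop E A B C D K s = rmat_eval H s) (at a)"
    by (auto elim!: eventually_mono)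
  from Lim_transform_eventually[OF tendsto_matrix_mult[OF tendsto_const closed_loop_tendsto[OF fb]] this]
  have lim: "(rmat_eval H \<longlongrightarrow> L ** closed_loop E A B C D K a) (at a)" .
  then have "\<not> rmat_pole H a" by (auto simp: rmat_pole_def)
  then show ?thesis using rmat_eval_tendsto lim tendsto_unique[OF at_neq_bot] by blast
qed

section \<open>The Hermitian form\<close>

text \<open>Conjugate linear in the first argument. Its real part is the real inner product of the
  type, which allows positivity to be stated with \<open>\<bullet>\<close>, while the complex value
  is kept for rational functions and polarization.\<close>

definition cform :: "complex ^ 'k \<Rightarrow> complex ^ 'k \<Rightarrow> complex" where
  "cform v w = (\<Sum>i\<in>UNIV. cnj (v $ i) * w $ i)"

lemma Re_cform: "Re (cform v w) = v \<bullet> w"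
  by (simp add: cform_def inner_vec_def inner_complex_def)

lemma cform_adjoint: "cform v (M *v w) = cform (conj_transpose M *v v) w"
proof -
  have "cform v (M *v w) = (\<Sum>i\<in>UNIV. \<Sum>j\<in>UNIV. cnj (v $ i) * M $ i $ j * w $ j)"
    by (simp add: cform_def matrix_vector_mult_def sum_distrib_left mult_ac)
  also have "\<dots> = (\<Sum>j\<in>UNIV. \<Sum>i\<in>UNIV. cnj (v $ i) * M $ i $ j * w $ j)"
    by (rule sum.swap)
  also have "\<dots> = cform (conj_transpose M *v v) w"
    by (simp add: cform_def matrix_vector_mult_def conj_transpose_def transpose_def
        sum_distrib_left sum_distrib_right mult_ac)
  finally show ?thesis .
qed

lemma inner_adjoint: "v \<bullet> (M *v w) = (conj_transpose M *v v) \<bullet> w" for v :: "complex ^ 'k"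
  by (metis Re_cform cform_adjoint)

lemma conj_transpose_involution [simp]: "conj_transpose (conj_transpose M) = M"
  by (simp add: conj_transpose_def transpose_def vec_eq_iff)

lemma conj_transpose_add: "conj_transpose (M + N) = conj_transpose M + conj_transpose N"
  by (simp add: conj_transpose_def transpose_def vec_eq_iff)

text \<open>The sum is Hermitian by construction, and \<open>J\<close> and its adjoint have forms
  with the same real part, so the form of the sum is twice that of \<open>J\<close>.\<close>

lemma pos_def_hermitian_part:
  "pos_def (J + conj_transpose J) \<longleftrightarrow> (\<forall>v. v \<noteq> 0 \<longrightarrow> 0 < v \<bullet> (J *v v))"
proof -
  have "Re (\<Sum>i\<in>UNIV. cnj (v $ i) * ((J + conj_transpose J) *v v) $ i) = 2 * (v \<bullet> (J *v v))" for v
  proof -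
    have "Re (\<Sum>i\<in>UNIV. cnj (v $ i) * ((J + conj_transpose J) *v v) $ i)
        = v \<bullet> ((J + conj_transpose J) *v v)"
      using Re_cform[of v "(J + conj_transpose J) *v v"] by (simp add: cform_def)
    also have "\<dots> = v \<bullet> (J *v v) + v \<bullet> (conj_transpose J *v v)"
      by (simp add: matrix_vector_mult_add_rdistrib inner_add_right)
    also have "v \<bullet> (conj_transpose J *v v) = v \<bullet> (J *v v)"
      using inner_adjoint[of v "conj_transpose J" v] by (simp add: inner_commute)
    finally show ?thesis by simp
  qed
  then show ?thesis by (simp add: pos_def_def conj_transpose_add add.commute)
qed

lemma norm_smult: "norm (c *s x) = cmod c * norm x" for x :: "complex ^ 'k"
  by (simp add: norm_vec_def norm_mult L2_set_right_distrib)

lemma matrix_vector_bound: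
  fixes M :: "complex ^ 'c ^ 'r"
  obtains b where "b \<ge> 0" "\<And>x. norm (M *v x) \<le> b * norm x"
  using bounded_linear.nonneg_bounded[OF matrix_vector_mul_bounded_linear[of M]]
  by (auto simp: mult.commute)

section \<open>Linear growth\<close>

text \<open>Only positive real arguments are tested: a vector with \<open>S\<^sup>3 v = 0\<close>
  and \<open>S\<^sup>2 v \<noteq> 0\<close> already causes quadratic growth on that ray.\<close>

definition linear_growth :: "(real \<Rightarrow> 'a::real_normed_vector) \<Rightarrow> bool" where
  "linear_growth f \<longleftrightarrow> (\<exists>c. \<forall>\<^sub>F t in at_top. norm (f t) \<le> c * t)"

section \<open>Calculus of linear growth and positive real functions\<close>

lemma linear_growth_mono:
  assumes "linear_growth f" "\<forall>\<^sub>F t in at_top. norm (g t) \<le> b * norm (f t)" "b \<ge> 0"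
  shows "linear_growth g"
proof -
  obtain c where "\<forall>\<^sub>F t in at_top. norm (f t) \<le> c * t" using assms(1) by (auto simp: linear_growth_def)
  with assms(2) have "\<forall>\<^sub>F t in at_top. norm (g t) \<le> (b * c) * t"
  proof eventually_elim
    case (elim t)
    have "b * norm (f t) \<le> b * (c * t)" by (intro mult_left_mono elim assms)
    then show ?case using elim by simp
  qed
  then show ?thesis by (auto simp: linear_growth_def)
qed

lemma linear_growth_const: "linear_growth (\<lambda>t. c)"
proof -
  have "\<forall>\<^sub>F t in at_top. norm c \<le> norm c * t"
    using eventually_ge_at_top[of 1] by eventually_elim (simp add: mult_le_cancel_left1)
  then show ?thesis by (auto simp: linear_growth_def)
qed

lemma linear_growth_add:
  assumes "linear_growth f" "linear_growth g"
  shows "linear_growth (\<lambda>t. f t + g t)"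
proof -
  obtain c d where "\<forall>\<^sub>F t in at_top. norm (f t) \<le> c * t" "\<forall>\<^sub>F t in at_top. norm (g t) \<le> d * t"
    using assms by (auto simp: linear_growth_def)
  then have "\<forall>\<^sub>F t in at_top. norm (f t + g t) \<le> (c + d) * t"
    by eventually_elim (simp add: distrib_right norm_triangle_le)
  then show ?thesis by (auto simp: linear_growth_def)
qed

lemma linear_growth_sum: "(\<And>i. i \<in> I \<Longrightarrow> linear_growth (f i)) \<Longrightarrow> linear_growth (\<lambda>t. \<Sum>i\<in>I. f i t)"
  by (induction I rule: infinite_finite_induct) (auto intro: linear_growth_add linear_growth_const)

lemma linear_growth_cmult: "linear_growth f \<Longrightarrow> linear_growth (\<lambda>t. c * f t)"
  for f :: "real \<Rightarrow> complex"
  by (rule linear_growth_mono[where b = "cmod c"]) (auto simp: norm_mult)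

lemma linear_growth_vec:
  fixes f :: "real \<Rightarrow> complex ^ 'k"
  assumes "\<And>i. linear_growth (\<lambda>t. f t $ i)"
  shows "linear_growth f"
proof -
  have "linear_growth (\<lambda>t. \<Sum>i\<in>UNIV. norm (f t $ i))"
    using assms by (intro linear_growth_sum) (simp add: linear_growth_def)
  then show ?thesis
    by (rule linear_growth_mono[where b = 1])
      (auto simp: norm_vec_def intro!: always_eventually L2_set_le_sum order_trans[OF _ abs_ge_self])
qed

text \<open>If \<open>p/q\<close> grew like \<open>a s\<^sup>k\<close> with \<open>k \<ge> 2\<close>, then \<open>a s\<^sup>k\<close> would be negative on some ray in the
  closed right half-plane.\<close>

lemma positive_real_degree:
  fixes p q :: "complex poly"
  assumes "\<And>s. 0 \<le> Re s \<Longrightarrow> 0 \<le> Re (poly p s / poly q s)" and q: "q \<noteq> 0"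
  shows "degree p \<le> degree q + 1"
proof (rule ccontr)
  assume "\<not> ?thesis"
  then have "degree p = degree q + (degree p - degree q)" "degree p - degree q \<ge> 2" by auto
  then obtain k where k: "degree p = degree q + k" "k \<ge> 2" by blast
  define a where "a = lead_coeff p / lead_coeff q"
  have "degree p \<noteq> 0" using k by simp
  then have "p \<noteq> 0" by auto
  then have a: "a \<noteq> 0" using q by (simp add: a_def)
  have "((\<lambda>s. (poly p s / s ^ degree p) / (poly q s / s ^ degree q)) \<longlongrightarrow> a) at_infinity"
    unfolding a_def using q by (intro tendsto_divide poly_divide_tendsto_aux) simp
  moreover have "\<forall>\<^sub>F s in at_infinity. (poly p s / s ^ degree p) / (poly q s / s ^ degree q)
      = poly p s / poly q s / s ^ k"
    using eventually_not_equal_at_infinity[of 0]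
    by eventually_elim (simp add: k power_add)
  ultimately have lim: "((\<lambda>s. poly p s / poly q s / s ^ k) \<longlongrightarrow> a) at_infinity"
    by (rule Lim_transform_eventually)
  \<comment> \<open>\<phi> completes the argument of \<open>a\<close> to \<pi> or -\<pi>, with the
    sign that keeps its modulus at most \<pi>. As \<open>k \<ge> 2\<close>, the root
    \<open>\<omega>\<close> stays in the closed right half-plane, while
    \<open>\<omega> ^ k * a\<close> is negative.\<close>
  define \<phi> where "\<phi> = (if Arg a \<ge> 0 then pi - Arg a else - pi - Arg a)"
  define \<omega> where "\<omega> = cis (\<phi> / k)"
  have \<phi>: "\<bar>\<phi>\<bar> \<le> pi" using Arg_bounded[of a] by (auto simp: \<phi>_def)
  have "\<bar>\<phi> / k\<bar> \<le> pi / 2"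
    using frac_le[of pi "\<bar>\<phi>\<bar>" 2 "real k"] k \<phi> by (simp add: abs_divide)
  then have Re: "Re \<omega> \<ge> 0" unfolding \<omega>_def cis.simps by (intro cos_ge_zero) linarith+
  have "cis (real k * (\<phi> / real k)) = cis \<phi>" using k by simp
  then have "\<omega> ^ k = cis \<phi>" by (simp only: \<omega>_def Complex.DeMoivre)
  moreover have "a = of_real (cmod a) * cis (Arg a)"
    by (metis rcis_cmod_Arg rcis_def)
  ultimately have "\<omega> ^ k * a = of_real (cmod a) * cis (\<phi> + Arg a)"
    by (simp add: cis_mult[symmetric] mult_ac)
  moreover have "cis (\<phi> + Arg a) = - 1"
    by (auto simp: \<phi>_def complex_eq_iff)
  ultimately have wa: "\<omega> ^ k * a = - of_real (cmod a)" by simp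
  have "filterlim (\<lambda>t. of_real t * \<omega>) at_infinity at_top"
    by (rule filterlim_norm_at_top_imp_at_infinity)
      (simp add: \<omega>_def norm_mult filterlim_abs_real)
  from filterlim_compose[OF lim this]
  have "((\<lambda>t. \<omega> ^ k * (poly p (of_real t * \<omega>) / poly q (of_real t * \<omega>) / (of_real t * \<omega>) ^ k))
      \<longlongrightarrow> \<omega> ^ k * a) at_top"
    by (rule tendsto_mult_left)
  moreover have "\<forall>\<^sub>F t in at_top. \<omega> ^ k * (poly p (of_real t * \<omega>) / poly q (of_real t * \<omega>) / (of_real t * \<omega>) ^ k)
      = (poly p (of_real t * \<omega>) / poly q (of_real t * \<omega>)) / of_real (t ^ k)"
    by (intro always_eventually allI) (simp add: \<omega>_def power_mult_distrib)
  ultimately have "((\<lambda>t. (poly p (of_real t * \<omega>) / poly q (of_real t * \<omega>)) / of_real (t ^ k))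
      \<longlongrightarrow> - of_real (cmod a)) at_top"
    unfolding wa by (rule Lim_transform_eventually)
  then have "((\<lambda>t. Re ((poly p (of_real t * \<omega>) / poly q (of_real t * \<omega>)) / of_real (t ^ k)))
      \<longlongrightarrow> Re (- of_real (cmod a))) at_top"
    by (rule tendsto_Re)
  moreover have "\<forall>\<^sub>F t in at_top. Re ((poly p (of_real t * \<omega>) / poly q (of_real t * \<omega>)) / of_real (t ^ k)) \<ge> 0"
    using eventually_gt_at_top[of 0]
  proof eventually_elim
    case (elim t)
    then have "Re (of_real t * \<omega>) \<ge> 0" using Re by simp
    from assms(1)[OF this] show ?case using elim unfolding Re_divide_of_real by simp
  qed
  ultimately have "Re (- of_real (cmod a)) \<ge> 0"
    by (intro tendsto_lowerbound[OF _ _ trivial_limit_at_top_linorder])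
  then show False using a by simp
qed

text \<open>The degree bound gives the quotient, divided by \<open>s\<close>, a finite limit at
  infinity; it is therefore eventually bounded along the real axis.\<close>

lemma positive_real_linear_growth:
  fixes p q :: "complex poly"
  assumes "\<And>s. 0 \<le> Re s \<Longrightarrow> 0 \<le> Re (poly p s / poly q s)" and q: "q \<noteq> 0"
  shows "linear_growth (\<lambda>t. poly p (of_real t) / poly q (of_real t))"
proof -
  have deg: "degree p \<le> degree q + 1" by (rule positive_real_degree[OF assms])
  have "\<exists>L. ((\<lambda>s. poly p s / s ^ (degree q + 1)) \<longlongrightarrow> L) at_infinity"
  proof (cases "degree p = degree q + 1")
    case True
    then show ?thesis using poly_divide_tendsto_aux[of p] by auto
  next
    case False
    then show ?thesis
      using poly_divide_tendsto_0_at_infinity[of p "monom 1 (degree q + 1)"] deg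
      by (auto simp: degree_monom_eq poly_monom)
  qed
  then obtain L where "((\<lambda>s. poly p s / s ^ (degree q + 1)) \<longlongrightarrow> L) at_infinity" ..
  then have "((\<lambda>s. (poly p s / s ^ (degree q + 1)) / (poly q s / s ^ degree q)) \<longlongrightarrow> L / lead_coeff q) at_infinity"
    using q by (intro tendsto_divide poly_divide_tendsto_aux) simp_all
  moreover have "\<forall>\<^sub>F s in at_infinity. (poly p s / s ^ (degree q + 1)) / (poly q s / s ^ degree q)
      = poly p s / poly q s / s"
    using eventually_not_equal_at_infinity[of 0] by eventually_elim simp
  ultimately have "((\<lambda>s. poly p s / poly q s / s) \<longlongrightarrow> L / lead_coeff q) at_infinity"
    by (rule Lim_transform_eventually)
  moreover have "filterlim (of_real :: real \<Rightarrow> complex) at_infinity at_top"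
    by (rule filterlim_norm_at_top_imp_at_infinity) (simp add: filterlim_abs_real)
  ultimately have "((\<lambda>t. poly p (of_real t) / poly q (of_real t) / of_real t) \<longlongrightarrow> L / lead_coeff q) at_top"
    by (rule filterlim_compose)
  then have "((\<lambda>t. cmod (poly p (of_real t) / poly q (of_real t) / of_real t)) \<longlongrightarrow> cmod (L / lead_coeff q)) at_top"
    by (rule tendsto_norm)
  then have "\<forall>\<^sub>F t in at_top. cmod (poly p (of_real t) / poly q (of_real t) / of_real t) < cmod (L / lead_coeff q) + 1"
    by (rule order_tendstoD) simp
  then have "\<forall>\<^sub>F t in at_top. cmod (poly p (of_real t) / poly q (of_real t)) \<le> (cmod (L / lead_coeff q) + 1) * t"
    using eventually_gt_at_top[of 0]
  proof eventually_elim
    case (elim t)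
    define z where "z = poly p (complex_of_real t) / poly q (complex_of_real t)"
    have "cmod (z / of_real t) * t \<le> (cmod (L / lead_coeff q) + 1) * t"
      using elim by (intro mult_right_mono) (auto simp: z_def)
    moreover have "cmod (z / of_real t) * t = cmod z" using elim by (simp add: norm_divide)
    ultimately show ?case by (simp only: z_def)
  qed
  then show ?thesis by (auto simp: linear_growth_def)
qed

text \<open>The state equation bounds \<open>E x\<close> and the output equation bounds \<open>C x\<close>.\<close>

lemma linear_growth_state:
  fixes E A :: "complex ^ 'n ^ 'n" and B :: "complex ^ 'm ^ 'n" and C :: "complex ^ 'n ^ 'm"
  assumes inj: "\<And>x. col_block E C *v x = 0 \<Longrightarrow> x = 0"
    and eq: "\<forall>\<^sub>F t in at_top. rosenbrock E A B C D (of_real t) *v joinv (x t) (u t) = joinv w v"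
    and u: "linear_growth u"
  shows "linear_growth x"
proof -
  have "linear ((*v) (col_block E C))"
    using matrix_vector_mul_bounded_linear bounded_linear.linear by blast
  moreover have "inj ((*v) (col_block E C))"
    using inj by (simp add: vec.inj_iff_eq_0)
  ultimately obtain b where b: "b > 0" "\<And>x. b * norm x \<le> norm (col_block E C *v x)"
    using linear_inj_bounded_below_pos by blast
  have nj: "norm (joinv y z) \<le> norm y + norm z" for y :: "complex ^ 'n" and z :: "complex ^ 'm"
    unfolding norm_vec_def L2_set_def
    by (simp add: sum_UNIV_sum_type sqrt_add_le_add_sqrt sum_nonneg)
  \<comment> \<open>An injective linear map in finite dimension is bounded below, so control of
    \<open>E x\<close> and \<open>C x\<close> is control of \<open>x\<close>.\<close>
  have xb: "b * norm x \<le> norm (E *v x) + norm (C *v x)" for x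
    using b(2)[of x] nj[of "E *v x" "C *v x"] by (simp add: block_mult_joinv)
  obtain nA nB nD where n: "nA \<ge> 0" "\<And>x. norm (A *v x) \<le> nA * norm x" "nB \<ge> 0"
    "\<And>x. norm (B *v x) \<le> nB * norm x" "nD \<ge> 0" "\<And>x. norm (D *v x) \<le> nD * norm x"
    using matrix_vector_bound by metis
  have "linear_growth (\<lambda>t. (nB + nD) * norm (u t))"
    by (rule linear_growth_mono[OF u, where b = "nB + nD"]) (use n in \<open>simp_all add: abs_mult\<close>)
  then have "linear_growth (\<lambda>t. (nB + nD) * norm (u t) + (norm w + norm v))"
    by (intro linear_growth_add linear_growth_const)
  then have g: "linear_growth (\<lambda>t. (2 / b) * ((nB + nD) * norm (u t) + (norm w + norm v)))"
  proof (rule linear_growth_mono[where b = "2 / b"])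
    have *: "norm ((2 / b) * r) \<le> 2 / b * norm r" for r :: real using b by (simp add: abs_mult)
    show "\<forall>\<^sub>F t in at_top. norm ((2 / b) * ((nB + nD) * norm (u t) + (norm w + norm v)))
        \<le> 2 / b * norm ((nB + nD) * norm (u t) + (norm w + norm v))"
      by (intro always_eventually allI *)
  qed (use b in simp)
  show ?thesis
  proof (rule linear_growth_mono[OF g, where b = 1])
    show "\<forall>\<^sub>F t in at_top. norm (x t) \<le> 1 * norm ((2 / b) * ((nB + nD) * norm (u t) + (norm w + norm v)))"
      \<comment> \<open>Beyond \<open>2 * nA / b\<close> the term \<open>nA * norm x\<close>,
        divided by \<open>t\<close>, is at most \<open>b / 2 * norm x\<close> and is absorbed by the
        left side of \<open>xb\<close>.\<close>
      using eq eventually_ge_at_top[of "max 1 (2 * nA / b)"]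
    proof eventually_elim
      case (elim t)
      then have t: "t \<ge> 1" "2 * nA / b \<le> t" by auto
      have eqs: "of_real t *s (E *v x t) = A *v x t + (B *v u t + w)" "C *v x t = - (v + D *v u t)"
        using elim(1) by (auto simp: rosenbrock_joinv algebra_simps)
      have "t * norm (E *v x t) = norm (A *v x t + (B *v u t + w))"
        using t by (simp flip: eqs(1) add: norm_smult)
      also have "\<dots> \<le> nA * norm (x t) + (nB * norm (u t) + norm w)"
        using n(2,4,6) by (meson add_mono norm_triangle_le order_refl)
      finally have "t * norm (E *v x t) \<le> nA * norm (x t) + (nB * norm (u t) + norm w)" .
      moreover have "nA \<le> t * b / 2" using t b by (simp add: field_simps)
      then have "nA * norm (x t) \<le> t * b / 2 * norm (x t)" by (intro mult_right_mono) auto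
      moreover have "nB * norm (u t) + norm w \<le> t * (nB * norm (u t) + norm w)"
        using mult_right_mono[of 1 t "nB * norm (u t) + norm w"] t n by simp
      ultimately have "t * norm (E *v x t) \<le> t * (b / 2 * norm (x t) + (nB * norm (u t) + norm w))"
        by (simp add: algebra_simps)
      then have 1: "norm (E *v x t) \<le> b / 2 * norm (x t) + (nB * norm (u t) + norm w)"
        using t by simp
      have 2: "norm (C *v x t) \<le> norm v + nD * norm (u t)"
        unfolding eqs(2) norm_minus_cancel using n(2,4,6) by (meson add_mono norm_triangle_le order_refl)
      have "b / 2 * norm (x t) \<le> (nB + nD) * norm (u t) + (norm w + norm v)"
        using xb[of "x t"] 1 2 by (simp add: algebra_simps)
      then have "norm (x t) \<le> (2 / b) * ((nB + nD) * norm (u t) + (norm w + norm v))"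
        using b by (simp add: field_simps)
      then show ?case by (simp only: real_norm_def)
    qed
  qed simp
qed

section \<open>Polarization and growth of the inverse pencil\<close>

lemma cform_add: "cform (v + v') w = cform v w + cform v' w" "cform v (w + w') = cform v w + cform v w'"
  by (simp_all add: cform_def algebra_simps sum.distrib)

lemma cform_diff: "cform (v - v') w = cform v w - cform v' w" "cform v (w - w') = cform v w - cform v w'"
  by (simp_all add: cform_def algebra_simps sum_subtractf)

lemma cform_smult: "cform (c *s v) w = cnj c * cform v w" "cform v (c *s w) = c * cform v w"
  by (simp_all add: cform_def sum_distrib_left mult_ac)

lemma cform_axis: "cform (axis k 1) w = w $ k"
proof -
  have "cnj (axis k 1 $ i) * w $ i = (if i = k then w $ i else 0)" for i
    by (simp add: axis_def)
  then show ?thesis by (simp add: cform_def)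
qed

lemma mult_axis: "(M *v axis l 1) $ k = M $ k $ l" for M :: "complex ^ 'c ^ 'r"
  by (simp add: matrix_vector_mult_def axis_def if_distrib cong: if_cong)

text \<open>Polarization: over the complex numbers a sesquilinear form is a fixed combination of
  four values of its quadratic form.\<close>

lemma linear_growth_sesquilinear:
  fixes N :: "real \<Rightarrow> complex ^ 'k ^ 'k"
  assumes "\<And>y. linear_growth (\<lambda>t. cform y (N t *v y))"
  shows "linear_growth (\<lambda>t. cform x (N t *v y))"
proof -
  have eq: "cform x (N t *v y) = (1 / 4) * (cform (x + y) (N t *v (x + y)))
      + (- (1 / 4)) * (cform (x - y) (N t *v (x - y)))
      + (\<i> / 4) * (cform (\<i> *s x + y) (N t *v (\<i> *s x + y)))
      + (- (\<i> / 4)) * (cform (\<i> *s x - y) (N t *v (\<i> *s x - y)))" for t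
    by (simp add: matrix_vector_right_distrib matrix_vector_mult_diff_distrib vector_scalar_commute
        cform_add cform_diff cform_smult algebra_simps)
  show ?thesis unfolding eq by (intro linear_growth_add linear_growth_cmult assms)
qed

text \<open>Cramer's rule applied to every entry, with the determinant of \<open>M s\<close> as
  common denominator \<open>q\<close>.\<close>

lemma matrix_inv_form_rational:
  fixes M :: "complex \<Rightarrow> complex ^ 'k ^ 'k"
  assumes M: "\<And>i j. polyfun (\<lambda>s. M s $ i $ j)" and "invertible (M s0)"
  obtains p q where "q \<noteq> 0"
    "\<And>s. invertible (M s) \<Longrightarrow> poly q s \<noteq> 0 \<and> cform a (matrix_inv (M s) *v b) = poly p s / poly q s"
proof -
  define N :: "'k \<Rightarrow> 'k \<Rightarrow> complex \<Rightarrow> complex ^ 'k ^ 'k"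
    where "N = (\<lambda>k l s. \<chi> i j. if j = k then axis l 1 $ i else M s $ i $ j)"
  have N: "polyfun (\<lambda>s. N k l s $ i $ j)" for i j k l
    using M by (cases "j = k") (simp_all add: N_def)
  define f where "f = (\<lambda>s. \<Sum>k\<in>UNIV. cnj (a $ k) * (\<Sum>l\<in>UNIV. det (N k l s) * b $ l))"
  have "polyfun f" unfolding f_def
    by (intro polyfun_sum polyfun_mult polyfun_const polyfun_det N)
  then obtain p where p: "\<And>s. f s = poly p s" by (auto simp: polyfun_def)
  have "polyfun (\<lambda>s. det (M s))" by (intro polyfun_det M)
  then obtain q where q: "\<And>s. det (M s) = poly q s" by (auto simp: polyfun_def)
  have nz: "poly q s \<noteq> 0" if "invertible (M s)" for s
    using that invertible_det_nz by (auto simp flip: q)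
  show thesis
  proof
    show "q \<noteq> 0" using nz[OF assms(2)] by auto
    fix s assume inv: "invertible (M s)"
    have "matrix_inv (M s) $ k $ l = det (N k l s) / poly q s" for k l
      using matrix_inv_cramer[OF inv] by (simp add: N_def q)
    then have "cform a (matrix_inv (M s) *v b) = f s / poly q s"
      by (simp add: cform_def f_def matrix_vector_mult_def sum_divide_distrib sum_distrib_left)
    then show "poly q s \<noteq> 0 \<and> cform a (matrix_inv (M s) *v b) = poly p s / poly q s"
      using nz[OF inv] by (simp add: p)
  qed
qed

lemma matrix_inv_transpose:
  fixes M :: "'a::field ^ 'k ^ 'k"
  assumes "invertible M"
  shows "matrix_inv (transpose M) = transpose (matrix_inv M)"
  by (rule matrix_inv_eqI) (simp_all add: inverse_matrix_inv[OF assms] flip: matrix_transpose_mul)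

lemma invertible_transpose:
  fixes M :: "'a::field ^ 'k ^ 'k"
  assumes "invertible M"
  shows "invertible (transpose M)"
proof -
  have "transpose M ** transpose (matrix_inv M) = mat 1"
    using inverse_matrix_inv[OF assms] by (simp flip: matrix_transpose_mul)
  then show ?thesis by (auto simp: invertible_right_inverse)
qed

lemma rosenbrock_transpose:
  "rosenbrock (transpose E) (transpose A) (transpose C) (transpose B) (transpose D) s =
     transpose (rosenbrock E A B C D s)"
  by (auto simp: rosenbrock_def four_block_def col_block_def row_block_def transpose_def vec_eq_iff
      split: sum.splits)

lemma rosenbrock_vector:
  fixes E A :: "complex ^ 'n ^ 'n" and D :: "complex ^ 'm ^ 'm"
  shows "rosenbrock E A B C D s *v z = s *s (four_block E 0 0 0 *v z) - four_block A B C D *v z"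
proof -
  obtain x u where z: "z = joinv x u" by (rule joinv_cases)
  have "joinv p (q :: complex ^ 'm) - joinv p' q' = joinv (p - p') (q - q')" for p p' :: "complex ^ 'n" and q q'
    by (simp add: joinv_def vec_eq_iff split: sum.splits)
  moreover have "s *s joinv p (q :: complex ^ 'm) = joinv (s *s p) (s *s q)" for p :: "complex ^ 'n" and q
    by (simp add: joinv_def vec_eq_iff split: sum.splits)
  ultimately show ?thesis
    by (simp add: z rosenbrock_joinv block_mult_joinv diff_diff_eq)
qed

lemma rosenbrock_feedback:
  assumes "rosenbrock E A B C D s *v joinv x u = joinv p (- y)"
  shows "C *v x + D *v u = y" "feedback_matrix E A B C D K s *v joinv x u = joinv p (u - K *v y)"
proof -
  have p: "s *s (E *v x) - A *v x - B *v u = p" and "- (C *v x + D *v u) = - y"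
    using assms unfolding rosenbrock_joinv joinv_eq_iff by blast+
  then show y: "C *v x + D *v u = y" by (simp only: neg_equal_iff_equal)
  show "feedback_matrix E A B C D K s *v joinv x u = joinv p (u - K *v y)"
    unfolding feedback_joinv p y ..
qed

text \<open>The lower row of the kernel equation says
  \<open>u = (I - K D)\<^sup>-\<^sup>1 K C x\<close>. Eliminating \<open>u\<close> leaves the
  eigenvector equation for \<open>x\<close>, and \<open>x = 0\<close> would force
  \<open>u = 0\<close>.\<close>

lemma feedback_invertible_iff:
  fixes K D :: "complex ^ 'm ^ 'm"
  assumes M: "invertible (mat 1 - K ** D)"
  shows "invertible (feedback_matrix E A B C D K s) \<longleftrightarrow>
    \<not> pair_eigenvalue E (A + B ** matrix_inv (mat 1 - K ** D) ** K ** C) s"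
proof -
  define I where "I = matrix_inv (mat 1 - K ** D)"
  have pe: "(map_matrix ((*) s) E - (A + B ** I ** K ** C)) *v x
      = s *s (E *v x) - A *v x - B *v (I *v (K *v (C *v x)))" for x
    by (simp add: matrix_vector_mult_diff_rdistrib matrix_vector_mult_add_rdistrib
        smult_matrix_vector flip: matrix_vector_mul_assoc)
  have u: "u - K *v (C *v x + D *v u) = 0 \<longleftrightarrow> u = I *v (K *v (C *v x))" for x u
  proof -
    have "u - K *v (C *v x + D *v u) = (mat 1 - K ** D) *v u - K *v (C *v x)"
      by (simp add: matrix_vector_mult_diff_rdistrib matrix_vector_right_distrib flip: matrix_vector_mul_assoc)
    then have "u - K *v (C *v x + D *v u) = 0 \<longleftrightarrow> (mat 1 - K ** D) *v u = K *v (C *v x)" by simp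
    also have "\<dots> \<longleftrightarrow> u = I *v (K *v (C *v x))"
      using matrix_inv_cancel_vector[OF M] unfolding I_def by metis
    finally show ?thesis .
  qed
  have "(\<exists>z. z \<noteq> 0 \<and> feedback_matrix E A B C D K s *v z = 0) \<longleftrightarrow>
    (\<exists>x u. (x \<noteq> 0 \<or> u \<noteq> 0) \<and> s *s (E *v x) - A *v x - B *v u = 0 \<and> u = I *v (K *v (C *v x)))"
    (is "?l \<longleftrightarrow> ?r")
  proof
    assume ?l
    then obtain z where z: "z \<noteq> 0" "feedback_matrix E A B C D K s *v z = 0" by blast
    obtain x u where xu: "z = joinv x u" by (rule joinv_cases)
    have "x \<noteq> 0 \<or> u \<noteq> 0" using z(1) xu by simp
    moreover have "s *s (E *v x) - A *v x - B *v u = 0" "u - K *v (C *v x + D *v u) = 0"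
      using z(2) unfolding xu feedback_joinv joinv_eq_0_iff by auto
    ultimately show ?r using u by blast
  next
    assume ?r
    then obtain x u' where xu: "x \<noteq> 0 \<or> u' \<noteq> 0" "s *s (E *v x) - A *v x - B *v u' = 0"
      "u' - K *v (C *v x + D *v u') = 0" using u by blast
    then have "joinv x u' \<noteq> 0" "feedback_matrix E A B C D K s *v joinv x u' = 0"
      unfolding feedback_joinv joinv_eq_0_iff by auto
    then show ?l by blast
  qed
  also have "\<dots> \<longleftrightarrow> (\<exists>x. x \<noteq> 0 \<and> s *s (E *v x) - A *v x - B *v (I *v (K *v (C *v x))) = 0)"
    by auto
  finally show ?thesis
    unfolding pair_eigenvalue_def invertible_iff_kernel I_def[symmetric] pe by blast
qed

text \<open>A column of the inverse consists of a state part and an input part that solve the pencil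
  equation with a constant right-hand side, so growth of the input part passes to the state
  part.\<close>

lemma linear_growth_column:
  fixes E A :: "complex ^ 'n ^ 'n" and B :: "complex ^ 'm ^ 'n" and C :: "complex ^ 'n ^ 'm"
    and D :: "complex ^ 'm ^ 'm"
  defines "P \<equiv> (\<lambda>t::real. matrix_inv (rosenbrock E A B C D (of_real t)))"
  assumes inj: "\<And>x. col_block E C *v x = 0 \<Longrightarrow> x = 0"
    and inv: "\<forall>\<^sub>F t in at_top. invertible (rosenbrock E A B C D (of_real t))"
    and low: "\<And>i. linear_growth (\<lambda>t. P t $ Inr i $ b)"
  shows "linear_growth (\<lambda>t. P t $ k $ b)"
proof -
  define x where "x = (\<lambda>t. \<chi> a. P t $ Inl a $ b)"
  define u where "u = (\<lambda>t. \<chi> i. P t $ Inr i $ b)"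
  have xu: "P t *v axis b 1 = joinv (x t) (u t)" for t
    by (simp add: vec_eq_iff mult_axis joinv_def x_def u_def split: sum.splits)
  obtain w :: "complex ^ 'n" and v :: "complex ^ 'm" where wv: "axis b 1 = joinv w v" by (rule joinv_cases)
  have eq: "\<forall>\<^sub>F t in at_top. rosenbrock E A B C D (of_real t) *v joinv (x t) (u t) = joinv w v"
    using inv
  proof eventually_elim
    case (elim t)
    then show ?case unfolding xu[symmetric] wv[symmetric] P_def by (rule matrix_inv_cancel_vector)
  qed
  have u: "linear_growth u"
    by (rule linear_growth_vec) (simp add: u_def low)
  have x: "linear_growth x" by (rule linear_growth_state[OF inj eq u])
  show ?thesis
  proof (cases k)
    case (Inl a)
    have "norm (P t $ k $ b) \<le> 1 * norm (x t)" for t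
      using Finite_Cartesian_Product.norm_nth_le[of "x t" a] by (simp add: x_def Inl)
    then show ?thesis by (intro linear_growth_mono[OF x, where b = 1]) auto
  qed (use low in simp)
qed

text \<open>Two passes from the lower right block. The transposed system, whose injectivity
  condition is the rank condition on \<open>[E B]\<close>, extends the bound to all lower rows; the
  original system then extends it to every column.\<close>

lemma linear_growth_rosenbrock_inverse:
  fixes E A :: "complex ^ 'n ^ 'n" and B :: "complex ^ 'm ^ 'n" and C :: "complex ^ 'n ^ 'm"
    and D :: "complex ^ 'm ^ 'm"
  defines "P \<equiv> (\<lambda>t::real. matrix_inv (rosenbrock E A B C D (of_real t)))"
  assumes EB: "rank (row_block E B) = CARD('n)" and EC: "rank (col_block E C) = CARD('n)"
    and inv: "\<forall>\<^sub>F t in at_top. invertible (rosenbrock E A B C D (of_real t))"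
    and low: "\<And>i j. linear_growth (\<lambda>t. P t $ Inr i $ Inr j)"
  shows "linear_growth (\<lambda>t. P t $ k $ l)"
proof -
  have EC': "x = 0" if "col_block E C *v x = 0" for x
    using full_column_rank_kernel[OF EC that] .
  have EB': "x = 0" if "col_block (transpose E) (transpose B) *v x = 0" for x
  proof -
    have "x v* row_block E B = 0" using that by (simp add: block_mult_joinv row_block_left_mult)
    then show ?thesis using full_row_rank_left_kernel[OF EB] by blast
  qed
  let ?R = "rosenbrock (transpose E) (transpose A) (transpose C) (transpose B) (transpose D)"
  have tr: "\<forall>\<^sub>F t in at_top. matrix_inv (?R (of_real t)) $ a $ b = P t $ b $ a" for a b
    using inv
    by eventually_elim
      (simp add: rosenbrock_transpose matrix_inv_transpose P_def, simp add: transpose_def)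
  have tr_growth: "linear_growth (\<lambda>t. matrix_inv (?R (of_real t)) $ a $ b) \<longleftrightarrow> linear_growth (\<lambda>t. P t $ b $ a)" for a b
  proof
    assume "linear_growth (\<lambda>t. matrix_inv (?R (of_real t)) $ a $ b)"
    then show "linear_growth (\<lambda>t. P t $ b $ a)"
      by (rule linear_growth_mono[where b = 1]) (use tr[of a b] in \<open>auto elim!: eventually_mono\<close>)
  next
    assume "linear_growth (\<lambda>t. P t $ b $ a)"
    then show "linear_growth (\<lambda>t. matrix_inv (?R (of_real t)) $ a $ b)"
      by (rule linear_growth_mono[where b = 1]) (use tr[of a b] in \<open>auto elim!: eventually_mono\<close>)
  qed
  have inv': "\<forall>\<^sub>F t in at_top. invertible (?R (of_real t))"
    using inv by eventually_elim (simp add: rosenbrock_transpose invertible_transpose)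
  have "linear_growth (\<lambda>t. matrix_inv (?R (of_real t)) $ a $ Inr j)" for a j
    by (rule linear_growth_column[OF EB' inv']) (use low tr_growth in auto)
  then have "linear_growth (\<lambda>t. P t $ Inr i $ b)" for i b
    using tr_growth by blast
  then show ?thesis
    unfolding P_def by - (rule linear_growth_column[OF EC' inv])
qed

text \<open>If \<open>S\<^sup>3 v = 0\<close> but \<open>S\<^sup>2 v \<noteq> 0\<close>, the inverse
  pencil applied to the fixed vector \<open>- \<A> v\<close> grows quadratically.\<close>

lemma linear_growth_index:
  fixes E A :: "complex ^ 'n ^ 'n" and B :: "complex ^ 'm ^ 'n" and C :: "complex ^ 'n ^ 'm"
    and D :: "complex ^ 'm ^ 'm"
  defines "\<E> \<equiv> four_block E 0 0 0 :: complex ^ ('n + 'm) ^ ('n + 'm)" and "\<A> \<equiv> four_block A B C D"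
  defines "S \<equiv> matrix_inv \<A> ** \<E>"
  assumes \<A>: "invertible \<A>"
    and inv: "\<forall>\<^sub>F t in at_top. invertible (rosenbrock E A B C D (of_real t))"
    and growth: "\<And>k l. linear_growth (\<lambda>t. matrix_inv (rosenbrock E A B C D (of_real t)) $ k $ l)"
    and v: "S *v (S *v (S *v v)) = 0"
  shows "S *v (S *v v) = 0"
proof (rule ccontr)
  assume nz: "\<not> ?thesis"
  \<comment> \<open>The Neumann series of \<open>(I - t S)\<^sup>-\<^sup>1 v\<close>, which stops
    after three terms because \<open>S\<^sup>3 v = 0\<close>.\<close>
  define z where "z = (\<lambda>t::real. v + of_real t *s (S *v v) + of_real (t^2) *s (S *v (S *v v)))"
  have \<A>S: "\<A> *v (S *v x) = \<E> *v x" for x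
    by (simp add: S_def matrix_vector_mul_assoc matrix_mul_assoc inverse_matrix_inv[OF \<A>])
  have Rz: "rosenbrock E A B C D (of_real t) *v z t = - (\<A> *v v)" for t
  proof -
    have "rosenbrock E A B C D (of_real t) *v z t = \<A> *v (of_real t *s (S *v z t) - z t)"
      by (simp add: rosenbrock_vector \<E>_def[symmetric] \<A>_def[symmetric] \<A>S vector_scalar_commute
          matrix_vector_mult_diff_distrib)
    also have "of_real t *s (S *v z t) - z t = - v"
      by (simp add: z_def matrix_vector_right_distrib vector_scalar_commute v vector_add_ldistrib
          vector_smult_assoc power2_eq_square)
    finally show ?thesis by (simp add: uminus_matrix_vector)
  qed
  define a where "a = - (\<A> *v v)"
  define g where "g = (\<lambda>t::real. matrix_inv (rosenbrock E A B C D (of_real t)) *v a)"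
  have "g t $ k = (\<Sum>l\<in>UNIV. a $ l * matrix_inv (rosenbrock E A B C D (of_real t)) $ k $ l)" for t k
    by (simp add: g_def matrix_vector_mult_def mult.commute)
  then have "linear_growth (\<lambda>t. g t $ k)" for k
    by simp (intro linear_growth_sum linear_growth_cmult growth)
  then have "linear_growth g" by (rule linear_growth_vec)
  moreover have "\<forall>\<^sub>F t in at_top. norm (z t) \<le> 1 * norm (g t)"
    using inv
  proof eventually_elim
    case (elim t)
    have "g t = z t"
      unfolding g_def a_def Rz[symmetric, of t] using elim by (rule matrix_inv_cancel_vector)
    then show ?case by simp
  qed
  ultimately have "linear_growth z" by (rule linear_growth_mono) simp
  then obtain c where c: "\<forall>\<^sub>F t in at_top. norm (z t) \<le> c * t" by (auto simp: linear_growth_def)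
  define N where "N = norm (S *v (S *v v))"
  have N: "N > 0" using nz by (simp add: N_def)
  have "\<forall>\<^sub>F t::real in at_top. False"
    \<comment> \<open>\<open>t \<ge> 1\<close> absorbs \<open>norm v\<close> into
      \<open>norm v * t\<close>; the other threshold makes \<open>t * N\<close> exceed the constant
      that remains after cancelling one factor \<open>t\<close>.\<close>
    using c eventually_ge_at_top[of 1] eventually_gt_at_top[of "(c + norm v + norm (S *v v)) / N"]
  proof eventually_elim
    case (elim t)
    have "t^2 * N = norm (of_real (t^2) *s (S *v (S *v v)))"
      by (simp add: norm_smult N_def del: of_real_power)
    also have "\<dots> = norm (z t - (v + of_real t *s (S *v v)))" by (simp add: z_def)
    also have "\<dots> \<le> norm (z t) + (norm v + norm (of_real t *s (S *v v)))"
      by (intro norm_triangle_le_diff add_mono norm_triangle_ineq order_refl)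
    also have "\<dots> \<le> c * t + (norm v * t + t * norm (S *v v))"
      using elim by (intro add_mono) (auto simp: norm_smult mult_le_cancel_left1)
    finally have "t * (t * N) \<le> t * (c + norm v + norm (S *v v))"
      by (simp add: power2_eq_square algebra_simps)
    then have "t * N \<le> c + norm v + norm (S *v v)" using elim by simp
    then show ?case using elim N by (simp add: pos_divide_less_eq)
  qed
  then show False by simp
qed

section \<open>Necessity\<close>

text \<open>The closed loop sends the external input \<open>u - K y\<close> to \<open>y\<close>, so
  this is its positivity at that input. The inequality is weak because the external input may
  vanish.\<close>

lemma positive_closed_loop_inner:
  assumes fb: "invertible (feedback_matrix E A B C D K s)"
    and pos: "\<And>w. w \<noteq> 0 \<Longrightarrow> 0 < w \<bullet> (L *v (closed_loop E A B C D K s *v w))"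
    and xu: "rosenbrock E A B C D s *v joinv x u = joinv 0 (- y)"
  shows "0 \<le> (L *v y) \<bullet> (u - K *v y)"
proof -
  have "closed_loop E A B C D K s *v (u - K *v y) = y"
    using closed_loop_vector[OF rosenbrock_feedback(2)[OF xu] fb] rosenbrock_feedback(1)[OF xu] by simp
  then show ?thesis using pos[of "u - K *v y"]
    by (cases "u - K *v y = 0") (auto simp: inner_commute less_imp_le)
qed

text \<open>A kernel vector \<open>(x, u)\<close> has output zero, so \<open>u\<close> is an
  external input with zero response. Positivity forces \<open>u = 0\<close>, and the vector then
  lies in the kernel of the feedback matrix.\<close>

lemma positive_closed_loop_rosenbrock:
  assumes fb: "invertible (feedback_matrix E A B C D K s)"
    and pos: "\<And>w. w \<noteq> 0 \<Longrightarrow> 0 < w \<bullet> (L *v (closed_loop E A B C D K s *v w))"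
  shows "invertible (rosenbrock E A B C D s)"
  unfolding invertible_iff_kernel
proof (intro allI impI)
  fix z assume z: "rosenbrock E A B C D s *v z = 0"
  obtain x u where xu: "z = joinv x u" by (rule joinv_cases)
  have r: "rosenbrock E A B C D s *v joinv x u = joinv 0 (- 0)" using z xu by (simp add: joinv_0)
  have "closed_loop E A B C D K s *v u = 0"
    using closed_loop_vector[OF rosenbrock_feedback(2)[OF r] fb] rosenbrock_feedback(1)[OF r] by simp
  then have "u = 0" using pos[of u] by (cases "u = 0") auto
  then have "feedback_matrix E A B C D K s *v joinv x u = 0"
    using rosenbrock_feedback(2)[OF r, of K] by (simp add: joinv_0)
  then show "z = 0" using fb unfolding invertible_iff_kernel xu by blast
qed

lemma necessity:
  fixes E A :: "complex ^ 'n ^ 'n" and B :: "complex ^ 'm ^ 'n" and C :: "complex ^ 'n ^ 'm"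
    and D K L :: "complex ^ 'm ^ 'm"
  defines "\<E> \<equiv> four_block E 0 0 0 :: complex ^ ('n + 'm) ^ ('n + 'm)" and "\<A> \<equiv> four_block A B C D"
  assumes EB: "rank (row_block E B) = CARD('n)" and EC: "rank (col_block E C) = CARD('n)"
    and fb: "\<And>s. 0 \<le> Re s \<Longrightarrow> invertible (feedback_matrix E A B C D K s)"
    and pos: "\<And>s w. 0 \<le> Re s \<Longrightarrow> w \<noteq> 0 \<Longrightarrow> 0 < w \<bullet> (L *v (closed_loop E A B C D K s *v w))"
  shows "invertible \<A>" and "\<And>\<mu>. eigenvalue (matrix_inv \<A> ** \<E>) \<mu> \<Longrightarrow> \<mu> \<noteq> 0 \<Longrightarrow> Re \<mu> < 0"
    and "index_of_zero (matrix_inv \<A> ** \<E>) \<le> 2"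
proof -
  note [simp] = \<E>_def[symmetric] \<A>_def[symmetric]
  define R where "R = rosenbrock E A B C D"
  have R: "invertible (R s)" if "0 \<le> Re s" for s
    unfolding R_def using that by (intro positive_closed_loop_rosenbrock[OF fb pos])
  have Rz: "R s *v z = s *s (\<E> *v z) - \<A> *v z" for s z
    by (simp add: R_def rosenbrock_vector)
  \<comment> \<open>At \<open>s = 0\<close> the pencil is \<open>- \<A>\<close>.\<close>
  show \<A>: "invertible \<A>"
    using R[of 0] by (simp add: invertible_iff_kernel Rz)
  show "Re \<mu> < 0" if ev: "eigenvalue (matrix_inv \<A> ** \<E>) \<mu>" and \<mu>: "\<mu> \<noteq> 0" for \<mu>
  proof (rule ccontr)
    assume "\<not> Re \<mu> < 0"
    \<comment> \<open>An eigenvalue \<mu> of \<open>S\<close> makes the pencil singular at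
      \<open>1 / \<mu>\<close>, and inversion does not change the sign of the real part.\<close>
    then have "0 \<le> Re (1 / \<mu>)" by (simp add: Re_divide)
    obtain v where v: "v \<noteq> 0" "matrix_inv \<A> ** \<E> *v v = \<mu> *s v" using ev by (auto simp: eigenvalue_def)
    have "\<E> *v v = \<A> *v (matrix_inv \<A> ** \<E> *v v)"
      by (simp add: matrix_inv_cancel_vector[OF \<A>] flip: matrix_vector_mul_assoc)
    also have "\<dots> = \<mu> *s (\<A> *v v)" by (simp only: v(2) vector_scalar_commute)
    finally have "R (1 / \<mu>) *v v = 0" using \<mu> by (simp add: Rz vector_smult_assoc)
    then show False using R[OF \<open>0 \<le> Re (1 / \<mu>)\<close>] v(1) by (simp add: invertible_iff_kernel)
  qed
  define c where "c = closed_loop E A B C D K 0"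
  have c: "invertible c"
    unfolding invertible_iff_kernel c_def using pos[of 0] by force
  have L: "invertible L"
    unfolding invertible_iff_kernel
  proof (intro allI impI)
    \<comment> \<open>As \<open>c\<close> is onto, \<open>v\<close> is the response to the input
      \<open>matrix_inv c *v v\<close>; \<open>L *v v = 0\<close> makes the form vanish at that
      input, which must then be zero.\<close>
    fix v assume "L *v v = 0"
    then have "matrix_inv c *v v = 0"
      using pos[of 0 "matrix_inv c *v v"] matrix_inv_cancel_vector(1)[OF c, of v] by (force simp: c_def)
    then show "v = 0" using matrix_inv_cancel_vector(1)[OF c, of v] by simp
  qed
  define P where "P = (\<lambda>t::real. matrix_inv (R (of_real t)))"
  \<comment> \<open>The lower right block of the inverse pencil, multiplied by \<open>L'\<close>. Up
    to sign and the constant contributed by \<open>K\<close>, the real part of its quadratic form is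
    the inner product of \<open>L y\<close> with the external input, a positive real
    function.\<close>
  define N where "N = (\<lambda>t. conj_transpose L ** row_block 0 (mat 1) ** P t ** col_block 0 (mat 1))"
  have Nform: "cform x (N t *v y) = cform (joinv 0 (L *v x)) (P t *v joinv 0 y)" for x y t
  proof -
    obtain p q where pq: "P t *v joinv 0 y = joinv p q" by (rule joinv_cases)
    have "cform x (N t *v y) = cform (L *v x) q"
      by (simp add: N_def block_mult_joinv cform_adjoint pq flip: matrix_vector_mul_assoc)
    also have "\<dots> = cform (joinv 0 (L *v x)) (joinv p q)"
      by (simp add: cform_def sum_UNIV_sum_type)
    finally show ?thesis by (simp add: pq)
  qed
  have "linear_growth (\<lambda>t. cform y (N t *v y))" for y
  proof -
    have "\<And>i j. polyfun (\<lambda>s. R s $ i $ j)" "invertible (R 0)"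
      using polyfun_rosenbrock R[of 0] by (simp_all add: R_def)
    from matrix_inv_form_rational[OF this, of "joinv 0 (L *v y)" "joinv 0 (- y)"]
    obtain p q where q: "q \<noteq> 0" and pq: "\<And>s. invertible (R s) \<Longrightarrow> poly q s \<noteq> 0 \<and>
      cform (joinv 0 (L *v y)) (matrix_inv (R s) *v joinv 0 (- y)) = poly p s / poly q s"
      by metis
    define d where "d = cform (L *v y) (K *v y)"
    have pos': "0 \<le> Re (poly (p - smult d q) s / poly q s)" if s: "0 \<le> Re s" for s
    proof -
      obtain x u where xu: "matrix_inv (R s) *v joinv 0 (- y) = joinv x u" by (rule joinv_cases)
      then have r: "rosenbrock E A B C D s *v joinv x u = joinv 0 (- y)"
        using matrix_inv_cancel_vector(1)[OF R[OF s], of "joinv 0 (- y)"] by (simp add: R_def)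
      have "0 \<le> (L *v y) \<bullet> (u - K *v y)"
        by (rule positive_closed_loop_inner[OF fb[OF s] pos[OF s] r])
      also have "\<dots> = Re (cform (joinv 0 (L *v y)) (joinv x u) - d)"
        unfolding d_def
        by (simp add: cform_def sum_UNIV_sum_type flip: Re_cform) (simp add: algebra_simps sum_subtractf)
      also have "cform (joinv 0 (L *v y)) (joinv x u) - d = poly (p - smult d q) s / poly q s"
        using pq[OF R[OF s]] by (simp add: xu diff_divide_distrib)
      finally show ?thesis .
    qed
    have "linear_growth (\<lambda>t. poly (p - smult d q) (of_real t) / poly q (of_real t))"
      by (rule positive_real_linear_growth[OF pos' q])
    then have g: "linear_growth (\<lambda>t. - 1 * (poly (p - smult d q) (of_real t) / poly q (of_real t) + d))"
      by (intro linear_growth_cmult linear_growth_add linear_growth_const)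
    show ?thesis
    proof (rule linear_growth_mono[OF g, where b = 1])
      show "\<forall>\<^sub>F t in at_top. cmod (cform y (N t *v y))
        \<le> 1 * cmod (- 1 * (poly (p - smult d q) (of_real t) / poly q (of_real t) + d))"
        using eventually_ge_at_top[of 0]
      proof eventually_elim
        case (elim t)
        then have inv: "invertible (R (of_real t))" by (intro R) simp
        have "joinv (0 :: complex ^ 'n) (- y) = - joinv 0 y" by (simp add: vec_eq_iff joinv_def split: sum.splits)
        moreover have "cform a (- b) = - cform a b" for a b :: "complex ^ ('n + 'm)"
          by (simp add: cform_def sum_negf)
        ultimately have "cform y (N t *v y) = - cform (joinv 0 (L *v y)) (P t *v joinv 0 (- y))"
          by (simp add: Nform uminus_matrix_vector)
        also have "\<dots> = - (poly p (of_real t) / poly q (of_real t))"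
          using pq[OF inv] by (simp add: P_def)
        also have "\<dots> = - 1 * (poly (p - smult d q) (of_real t) / poly q (of_real t) + d)"
          using pq[OF inv] by (simp add: diff_divide_distrib)
        finally show ?case by simp
      qed
    qed simp
  qed
  note N_growth = linear_growth_sesquilinear[OF this]
  have low: "linear_growth (\<lambda>t. P t $ Inr i $ Inr j)" for i j
  proof -
    have ax: "axis (Inr l) 1 = joinv 0 (axis l 1)" for l :: 'm
      by (simp add: vec_eq_iff joinv_def axis_def split: sum.splits)
    \<comment> \<open>The test vector \<open>matrix_inv L *v axis i 1\<close> cancels the factor
      \<open>L'\<close> and leaves a single entry of the inverse pencil.\<close>
    have "cform (matrix_inv L *v axis i 1) (N t *v axis j 1) = P t $ Inr i $ Inr j" for t
      unfolding Nform matrix_inv_cancel_vector[OF L] ax[symmetric] cform_axis mult_axis ..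
    then show ?thesis using N_growth[of "matrix_inv L *v axis i 1" "axis j 1"] by simp
  qed
  have ev: "\<forall>\<^sub>F t in at_top. invertible (rosenbrock E A B C D (of_real t))"
    using eventually_ge_at_top[of 0] by eventually_elim (use R in \<open>auto simp: R_def\<close>)
  have growth: "linear_growth (\<lambda>t. matrix_inv (rosenbrock E A B C D (of_real t)) $ k $ l)" for k l
    by (rule linear_growth_rosenbrock_inverse[OF EB EC ev]) (use low in \<open>simp add: P_def R_def\<close>)
  define S where "S = matrix_inv \<A> ** \<E>"
  have "S *v (S *v v) = 0" if "S *v (S *v (S *v v)) = 0" for v
    using linear_growth_index[OF \<A>[unfolded \<A>_def] ev growth, of v] that
    unfolding S_def \<A>_def \<E>_def by blast
  then have "\<exists>Y. mat_pow S 2 = Y ** mat_pow S (Suc 2)"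
    by (intro kernel_factor) (simp add: numeral_2_eq_2 flip: matrix_vector_mul_assoc)
  then show "index_of_zero (matrix_inv \<A> ** \<E>) \<le> 2"
    by (simp add: index_of_zero_le_iff S_def)
qed

section \<open>Sufficiency\<close>

lemma finite_left_half_plane:
  assumes "finite Z" "\<And>s. s \<in> Z \<Longrightarrow> Re s < 0"
  shows "\<exists>\<epsilon>>0. \<forall>s\<in>Z. Re s < - \<epsilon>"
  using assms
proof (induction Z)
  case empty
  then show ?case by (auto intro: exI[of _ 1])
next
  case (insert s Z)
  then obtain \<epsilon> where "\<epsilon> > 0" "\<forall>s\<in>Z. Re s < - \<epsilon>" by auto
  moreover have "Re s < 0" using insert.prems by auto
  ultimately show ?case by (intro exI[of _ "min \<epsilon> (- Re s / 2)"]) auto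
qed

text \<open>For \<open>|s|\<close> large, \<open>S\<^sup>2 = Y S\<^sup>3\<close> turns the equation into \<open>(s - Y) S\<^sup>2 z = Y S\<^sup>2 g\<close>; the
  remaining \<open>s\<close> form a compact set.\<close>

lemma resolvent_square_bound:
  fixes S Y :: "complex ^ 'k ^ 'k"
  assumes Y: "S ** S = Y ** (S ** (S ** S))"
    and ker: "\<And>s z. - \<epsilon> \<le> Re s \<Longrightarrow> s *s (S *v z) = z \<Longrightarrow> z = 0" and "\<epsilon> > 0"
  shows "\<exists>c\<ge>0. \<forall>s z. - \<epsilon> \<le> Re s \<longrightarrow> norm (S *v (S *v z)) \<le> c * norm (s *s (S *v z) - z)"
proof -
  obtain bY where bY: "bY \<ge> 0" "\<And>x. norm (Y *v x) \<le> bY * norm x" 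
    using matrix_vector_bound[of "Y"] by blast
  obtain b2 where b2: "b2 \<ge> 0" "\<And>x. norm ((Y ** (S ** S)) *v x) \<le> b2 * norm x" 
    using matrix_vector_bound[of "Y ** (S ** S)"] by blast
  obtain bS where bS: "bS \<ge> 0" "\<And>x. norm ((S ** S) *v x) \<le> bS * norm x" 
    using matrix_vector_bound[of "S ** S"] by blast
  have large: "norm (S *v (S *v z)) \<le> b2 * norm (s *s (S *v z) - z)" if "bY + 1 \<le> cmod s" for s z
  proof -
    define g where "g = s *s (S *v z) - z"
    define q where "q = S *v (S *v z)"
    have Yq: "q = Y *v (S *v (S *v (S *v z)))"
      using Y by (simp add: q_def matrix_vector_mul_assoc)
    have "S *v (S *v g) = s *s (S *v (S *v (S *v z))) - q"
      by (simp add: g_def q_def matrix_vector_mult_diff_distrib vector_scalar_commute)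
    then have "Y *v (S *v (S *v g)) = s *s q - Y *v q"
      by (simp add: Yq[symmetric] matrix_vector_mult_diff_distrib vector_scalar_commute)
    then have "s *s q = Y *v q + (Y ** (S ** S)) *v g"
      by (simp add: matrix_vector_mul_assoc matrix_mul_assoc)
    then have "cmod s * norm q = norm (Y *v q + (Y ** (S ** S)) *v g)" by (metis norm_smult)
    also have "\<dots> \<le> bY * norm q + b2 * norm g" by (meson bY b2 add_mono norm_triangle_le)
    finally have "cmod s * norm q \<le> bY * norm q + b2 * norm g" .
    moreover have "(bY + 1) * norm q \<le> cmod s * norm q" using that by (intro mult_right_mono) auto
    ultimately show ?thesis by (simp add: q_def g_def algebra_simps)
  qed
  \<comment> \<open>The bound \<open>large\<close> covers the part of the half-plane outside \<K>.
    On \<K> times the unit sphere, which is compact, the norm of \<open>s S z - z\<close> attains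
    its minimum, positive because the kernel is trivial there.\<close>
  define \<K> where "\<K> = {s. - \<epsilon> \<le> Re s} \<inter> cball 0 (bY + 1)"
  have "compact \<K>"
    unfolding \<K>_def by (intro closed_Int_compact closed_halfspace_Re_ge compact_cball)
  then have comp: "compact (\<K> \<times> sphere (0 :: complex ^ 'k) 1)" by (intro compact_Times compact_sphere)
  have "0 \<in> \<K>" using \<open>\<epsilon> > 0\<close> bY by (simp add: \<K>_def)
  moreover obtain z1 :: "complex ^ 'k" where "norm z1 = 1" using vector_choose_size[of 1] by auto
  then have "z1 \<in> sphere 0 1" by simp
  ultimately have ne: "\<K> \<times> sphere (0 :: complex ^ 'k) 1 \<noteq> {}" by blast
  have cont: "continuous_on (\<K> \<times> sphere 0 1) (\<lambda>p. norm (fst p *s (S *v snd p) - snd p))"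
    unfolding vector_scalar_mult_def matrix_vector_mult_def by (intro continuous_intros)
  obtain s0 z0 where s0: "s0 \<in> \<K>" "norm z0 = 1"
    and min: "\<And>s z. s \<in> \<K> \<Longrightarrow> norm z = 1 \<Longrightarrow> norm (s0 *s (S *v z0) - z0) \<le> norm (s *s (S *v z) - z)"
    using continuous_attains_inf[OF comp ne cont] by auto
  define m where "m = norm (s0 *s (S *v z0) - z0)"
  have "z0 \<noteq> 0" using s0 by auto
  then have "m > 0" using ker[of s0 z0] s0 by (auto simp: m_def \<K>_def)
  have small: "m * norm z \<le> norm (s *s (S *v z) - z)" if "s \<in> \<K>" for s z
  proof (cases "z = 0")
    case False
    define r where "r = complex_of_real (inverse (norm z))"
    have "norm (r *s z) = 1" using False by (simp add: r_def norm_smult norm_inverse)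
    from min[OF that this] have "m \<le> norm (r *s (s *s (S *v z) - z))"
      by (simp add: m_def vector_scalar_commute vector_ssub_ldistrib vector_smult_assoc mult.commute)
    also have "\<dots> = norm (s *s (S *v z) - z) / norm z"
      by (subst norm_smult) (simp add: r_def norm_inverse divide_inverse mult.commute)
    finally show ?thesis using False by (simp add: field_simps)
  qed simp
  have "norm (S *v (S *v z)) \<le> max b2 (bS / m) * norm (s *s (S *v z) - z)" if "- \<epsilon> \<le> Re s" for s z
  proof (cases "s \<in> \<K>")
    case True
    have "norm (S *v (S *v z)) \<le> bS * norm z" using bS(2)[of z] by (simp add: matrix_vector_mul_assoc)
    also have "\<dots> = bS / m * (m * norm z)" using \<open>m > 0\<close> by simp
    also have "\<dots> \<le> bS / m * norm (s *s (S *v z) - z)"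
      using small[OF True, of z] bS \<open>m > 0\<close> by (intro mult_left_mono) auto
    also have "\<dots> \<le> max b2 (bS / m) * norm (s *s (S *v z) - z)" by (intro mult_right_mono) auto
    finally show ?thesis .
  next
    case False
    then have "bY + 1 \<le> cmod s" using that by (auto simp: \<K>_def)
    from large[OF this, of z] show ?thesis
      by (rule order_trans) (intro mult_right_mono, auto)
  qed
  then show ?thesis using b2(1) by (intro exI[of _ "max b2 (bS / m)"]) auto
qed

text \<open>With \<open>V\<close> an inner inverse of \<open>M\<close> and \<open>e = M V\<close> idempotent, the witness is
  \<open>X = V (e' + (1 - e) (1 - e)')\<close>: multiplication by \<open>M\<close> kills the second summand, which makes
  the first one invertible.\<close>

lemma invertible_semidefinite_factor:
  fixes M :: "complex ^ 'k ^ 'k"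
  assumes F: "F = \<real> \<or> F = UNIV" and M: "entries_in F M"
  obtains X e :: "complex ^ 'k ^ 'k" where "entries_in F X" "invertible X" "M ** X = e ** conj_transpose e"
proof -
  obtain V where V: "entries_in F V" "invertible V" "M ** V ** M = M"
    using entries_in_inner_inverse[OF F M] by blast
  define e where "e = M ** V"
  have ee: "e ** e = e" using V(3) by (simp add: e_def matrix_mul_assoc)
  define W where "W = conj_transpose e + (mat 1 - e) ** conj_transpose (mat 1 - e)"
  have eW: "e ** W = e ** conj_transpose e"
    by (simp add: W_def matrix_add_ldistrib matrix_mul_assoc matrix_mul_diff_distrib ee)
  \<comment> \<open>The inner product of \<open>v\<close> with \<open>c c' v\<close> is the squared
    norm of \<open>c' v\<close>.\<close>
  have c: "c *v (conj_transpose c *v v) = 0 \<Longrightarrow> conj_transpose c *v v = 0" for c :: "complex ^ 'k ^ 'k" and v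
    using inner_adjoint[of v c "conj_transpose c *v v"] by simp
  have W: "invertible W"
    unfolding invertible_iff_kernel
  proof (intro allI impI)
    fix v assume v: "W *v v = 0"
    then have "(e ** W) *v v = 0" by (simp flip: matrix_vector_mul_assoc)
    then have 1: "conj_transpose e *v v = 0"
      by (intro c) (simp add: eW matrix_vector_mul_assoc)
    then have "conj_transpose (mat 1 - e) *v v = 0"
      using v by (intro c) (simp add: W_def matrix_vector_mult_add_rdistrib matrix_vector_mul_assoc)
    moreover have "conj_transpose (mat 1 - e) = mat 1 - conj_transpose e"
      by (auto simp: conj_transpose_def transpose_def vec_eq_iff mat_def)
    ultimately show "v = 0" using 1 by (simp add: matrix_vector_mult_diff_rdistrib)
  qed
  show thesis
  proof
    show "entries_in F (V ** W)"
      unfolding W_def e_def by (intro entries_in_closed[OF F] V M)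
    show "invertible (V ** W)" by (intro invertible_mult V W)
    show "M ** (V ** W) = e ** conj_transpose e" by (simp add: matrix_mul_assoc eW flip: e_def)
  qed
qed

section \<open>Construction of the feedback and the multiplier\<close>

lemma sufficiency:
  fixes E A :: "complex ^ 'n ^ 'n" and B :: "complex ^ 'm ^ 'n" and C :: "complex ^ 'n ^ 'm"
    and D :: "complex ^ 'm ^ 'm"
  defines "\<E> \<equiv> four_block E 0 0 0 :: complex ^ ('n + 'm) ^ ('n + 'm)" and "\<A> \<equiv> four_block A B C D"
  assumes F: "F = \<real> \<or> F = UNIV"
    and entries: "entries_in F E" "entries_in F A" "entries_in F B" "entries_in F C" "entries_in F D"
    and \<A>: "invertible \<A>"
    and eig: "\<And>\<mu>. eigenvalue (matrix_inv \<A> ** \<E>) \<mu> \<Longrightarrow> \<mu> \<noteq> 0 \<Longrightarrow> Re \<mu> < 0"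
    and index: "index_of_zero (matrix_inv \<A> ** \<E>) \<le> 2"
  obtains K L \<epsilon> where "entries_in F K" "entries_in F L" "invertible (mat 1 - K ** D)" "\<epsilon> > 0"
    "\<forall>s. - \<epsilon> \<le> Re s \<longrightarrow> invertible (rosenbrock E A B C D s)"
    "\<forall>s x u y. - \<epsilon> \<le> Re s \<and> rosenbrock E A B C D s *v joinv x u = joinv 0 (- y) \<and> y \<noteq> 0 \<longrightarrow>
       0 < (L *v y) \<bullet> (u - K *v y)"
proof -
  note [simp] = \<E>_def[symmetric] \<A>_def[symmetric]
  define R where "R = rosenbrock E A B C D"
  define S where "S = matrix_inv \<A> ** \<E>"
  have Rz: "R s *v z = s *s (\<E> *v z) - \<A> *v z" for s z
    by (simp add: R_def rosenbrock_vector)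
  have RS: "matrix_inv \<A> *v (R s *v z) = s *s (S *v z) - z" for s z
    by (simp add: Rz S_def matrix_vector_mult_diff_distrib vector_scalar_commute
        matrix_inv_cancel_vector[OF \<A>] flip: matrix_vector_mul_assoc)
  define Z where "Z = {s. det (R s) = 0}"
  have "invertible (R 0)" using \<A> by (simp add: invertible_iff_kernel Rz)
  then have "det (R 0) \<noteq> 0" by (simp add: invertible_det_nz)
  then have finZ: "finite Z"
    unfolding Z_def by (intro polyfun_finite_zeros[where a = 0] polyfun_det) (simp_all add: R_def polyfun_rosenbrock)
  \<comment> \<open>A zero \<open>s\<close> of the determinant is non-zero and \<open>1 / s\<close>
    is an eigenvalue of \<open>S\<close>. The finitely many zeros therefore keep a positive distance
    \<epsilon> from the imaginary axis.\<close>
  have Zneg: "Re s < 0" if "s \<in> Z" for s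
  proof -
    have "\<not> invertible (R s)" using that by (simp add: Z_def invertible_det_nz)
    then obtain v where v: "v \<noteq> 0" "R s *v v = 0" by (auto simp: invertible_iff_kernel)
    then have sv: "s *s (S *v v) = v" using RS[of s v] by simp
    then have s: "s \<noteq> 0" using v by auto
    have "S *v v = (1 / s) *s (s *s (S *v v))" using s by (simp add: vector_smult_assoc)
    then have "eigenvalue S (1 / s)" using v(1) sv by (auto simp: eigenvalue_def)
    then have "Re (1 / s) < 0" using eig[of "1 / s"] s by (simp add: S_def)
    moreover have "0 \<le> Re (1 / s)" if "0 \<le> Re s" using that by (simp add: Re_divide)
    ultimately show ?thesis by linarith
  qed
  from finite_left_half_plane[OF finZ Zneg]
  obtain \<epsilon> where \<epsilon>: "\<epsilon> > 0" "\<And>s. s \<in> Z \<Longrightarrow> Re s < - \<epsilon>" by auto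
  have Rinv: "invertible (R s)" if "- \<epsilon> \<le> Re s" for s
    using \<epsilon>(2)[of s] that by (force simp: Z_def invertible_det_nz)
  have ker: "z = 0" if "- \<epsilon> \<le> Re s" "s *s (S *v z) = z" for s z
  proof -
    have "matrix_inv \<A> *v (R s *v z) = 0" using that RS by simp
    then have "R s *v z = 0" using matrix_inv_cancel_vector(1)[OF \<A>, of "R s *v z"] by simp
    then show ?thesis using Rinv[OF that(1)] by (simp add: invertible_iff_kernel)
  qed
  have FE: "entries_in F \<E>" "entries_in F \<A>"
    unfolding \<E>_def \<A>_def by (intro entries_in_four_block entries entries_in_closed[OF F])+
  have FS: "entries_in F S"
    unfolding S_def by (intro entries_in_closed[OF F] entries_in_matrix_inv[OF F] FE \<A>)
  obtain Y0 where "S ** S = Y0 ** (S ** (S ** S))"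
    using index by (auto simp: index_of_zero_le_iff S_def[symmetric] numeral_2_eq_2)
  moreover have "entries_in F (S ** S)" "entries_in F (S ** (S ** S))"
    by (intro entries_in_closed[OF F] FS)+
  \<comment> \<open>\<open>M\<close> is built from \<open>Y\<close>, and \<open>X\<close>,
    \<open>L\<close> and \<open>K\<close> from \<open>M\<close>, so \<open>Y\<close> needs entries
    in the ground field.\<close>
  ultimately obtain Y where Y: "entries_in F Y" "S ** S = Y ** (S ** (S ** S))"
    using entries_in_left_factor[OF F] by blast
  have "\<exists>c\<ge>0. \<forall>s z. - \<epsilon> \<le> Re s \<longrightarrow> norm (S *v (S *v z)) \<le> c * norm (s *s (S *v z) - z)"
    by (rule resolvent_square_bound[OF Y(2) ker \<epsilon>(1)])
  then obtain c where c: "c \<ge> 0"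
    "\<And>s z. - \<epsilon> \<le> Re s \<Longrightarrow> norm (S *v (S *v z)) \<le> c * norm (s *s (S *v z) - z)" by auto
  define T :: "complex ^ ('n + 'm) ^ 'm" where "T = row_block 0 (mat 1)"
  define W where "W = matrix_inv \<A> ** col_block 0 (mat 1)"
  \<comment> \<open>The coefficient of \<open>s\<close> in the map from the output \<open>y\<close>
    to the total input \<open>u\<close>: \<open>W\<close> turns the output into a right-hand side
    and \<open>T\<close> selects the input component of the solution.\<close>
  define M where "M = T ** (S - Y ** (S ** S)) ** W"
  have "entries_in F T" "entries_in F (col_block 0 (mat 1) :: complex ^ 'm ^ ('n + 'm))"
    using RC_closed[OF F]
    by (auto simp: T_def entries_in_def row_block_def col_block_def mat_def split: sum.splits)
  then have FM: "entries_in F M"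
    unfolding M_def W_def by (intro entries_in_closed[OF F] entries_in_matrix_inv[OF F] FS FE Y \<A>)
  obtain X e :: "complex ^ 'm ^ 'm"
    where X: "entries_in F X" "invertible X" "M ** X = e ** conj_transpose e"
    by (rule invertible_semidefinite_factor[OF F FM])
  define L where "L = matrix_inv X"
  have FL: "entries_in F L" unfolding L_def by (intro entries_in_matrix_inv[OF F] X)
  obtain bT where bT: "bT \<ge> 0" "\<And>x. norm (T *v x) \<le> bT * norm x" 
    using matrix_vector_bound[of "T"] by blast
  obtain bY where bY: "bY \<ge> 0" "\<And>x. norm ((Y ** Y) *v x) \<le> bY * norm x" 
    using matrix_vector_bound[of "Y ** Y"] by blast
  obtain b2 where b2: "b2 \<ge> 0" "\<And>x. norm ((Y ** Y ** (S ** S)) *v x) \<le> b2 * norm x" 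
    using matrix_vector_bound[of "Y ** Y ** (S ** S)"] by blast
  obtain bW where bW: "bW \<ge> 0" "\<And>x. norm ((W ** X) *v x) \<le> bW * norm x" 
    using matrix_vector_bound[of "W ** X"] by blast
  obtain be where be: "be \<ge> 0" "\<And>x. norm (conj_transpose e *v x) \<le> be * norm x" 
    using matrix_vector_bound[of "conj_transpose e"] by blast
  \<comment> \<open>The first summand covers the semidefinite term \<open>s e e'\<close> down to
    \<open>Re s = - \<epsilon>\<close>; the second bounds the remainder \<open>T r\<close> by the
    Cauchy-Schwarz inequality.\<close>
  define k0 where "k0 = \<epsilon> * be^2 + bT * ((bY * c + b2 + 1) * bW)"
  have lower: "- k0 * (norm v)^2 \<le> v \<bullet> u"
    if s: "- \<epsilon> \<le> Re s" and Ru: "R s *v joinv x u = joinv 0 (- (X *v v))" for s x u v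
  proof -
    define z where "z = joinv x u"
    define g where "g = s *s (S *v z) - z"
    define q where "q = S *v (S *v z)"
    \<comment> \<open>This equals \<open>s Y q - g\<close>, rewritten by
      \<open>Y\<^sup>2 S\<^sup>2 g = s Y q - Y\<^sup>2 q\<close> so that no factor \<open>s\<close>
      remains; with the bound on \<open>q\<close> it is at most a constant times the norm of
      \<open>g\<close>, uniformly in \<open>s\<close>.\<close>
    define r where "r = (Y ** Y) *v q + (Y ** Y ** (S ** S)) *v g - g"
    have "joinv (0 :: complex ^ 'n) (- (X *v v)) = - joinv 0 (X *v v)" by (simp add: vec_eq_iff joinv_def split: sum.splits)
    then have g: "g = - ((W ** X) *v v)"
      using RS[of s z] Ru
      by (simp add: g_def z_def W_def block_mult_joinv uminus_matrix_vector flip: matrix_vector_mul_assoc)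
    have "q = Y *v (S *v (S *v (S *v z)))"
      using Y(2) by (simp add: q_def matrix_vector_mul_assoc)
    moreover have "S *v (S *v g) = s *s (S *v (S *v (S *v z))) - q"
      by (simp add: g_def q_def matrix_vector_mult_diff_distrib vector_scalar_commute)
    ultimately have Yg: "Y *v (S *v (S *v g)) = s *s q - Y *v q"
      by (simp add: matrix_vector_mult_diff_distrib vector_scalar_commute)
    have Sz: "S *v g = s *s q - S *v z"
      by (simp add: g_def q_def matrix_vector_mult_diff_distrib vector_scalar_commute)
    have YYg: "Y *v (Y *v (S *v (S *v g))) = s *s (Y *v q) - Y *v (Y *v q)"
      by (simp add: Yg matrix_vector_mult_diff_distrib vector_scalar_commute)
    have "z = r - s *s ((S - Y ** (S ** S)) *v g)"
    proof -
      have "r = s *s (Y *v q) - g"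
        using YYg by (simp add: r_def flip: matrix_vector_mul_assoc)
      moreover have "(S - Y ** (S ** S)) *v g = S *v g - Y *v (S *v (S *v g))"
        by (simp add: matrix_vector_mult_diff_rdistrib flip: matrix_vector_mul_assoc)
      then have "(S - Y ** (S ** S)) *v g = Y *v q - S *v z"
        unfolding Yg unfolding Sz by simp
      ultimately show ?thesis by (simp add: g_def vector_ssub_ldistrib)
    qed
    then have "T *v z = T *v r + s *s (M *v (X *v v))"
      by (simp add: g M_def matrix_vector_right_distrib matrix_vector_mult_diff_distrib vector_scalar_commute uminus_matrix_vector
          flip: matrix_vector_mul_assoc)
    moreover have "T *v z = u" by (simp add: T_def z_def block_mult_joinv)
    ultimately have u: "u = T *v r + s *s (e *v (conj_transpose e *v v))"
      by (simp add: matrix_vector_mul_assoc X(3))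
    have "v \<bullet> (s *s (e *v (conj_transpose e *v v))) = (conj_transpose e *v v) \<bullet> (s *s (conj_transpose e *v v))"
      by (simp add: inner_adjoint flip: vector_scalar_commute)
    also have "\<dots> = Re s * (norm (conj_transpose e *v v))^2"
    proof -
      have "w \<bullet> (s *s w) = Re s * (w \<bullet> w)" for w :: "complex ^ 'm"
        by (simp add: inner_vec_def inner_complex_def sum_distrib_left algebra_simps)
      then show ?thesis by (simp add: power2_norm_eq_inner)
    qed
    also have "\<dots> \<ge> - \<epsilon> * (be * norm v)^2"
    proof -
      have "\<epsilon> * (norm (conj_transpose e *v v))^2 \<le> \<epsilon> * (be * norm v)^2"
        using be \<epsilon> by (intro mult_left_mono power_mono) auto
      moreover have "- \<epsilon> * (norm (conj_transpose e *v v))^2 \<le> Re s * (norm (conj_transpose e *v v))^2"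
        using s by (intro mult_right_mono) auto
      ultimately show ?thesis by simp
    qed
    finally have 1: "- \<epsilon> * (be * norm v)^2 \<le> v \<bullet> (s *s (e *v (conj_transpose e *v v)))" .
    have ng: "norm g \<le> bW * norm v" using bW(2)[of v] by (simp add: g)
    have "norm q \<le> c * norm g" using c(2)[OF s, of z] by (simp add: q_def g_def)
    then have "bY * norm q \<le> bY * (c * norm g)" using bY by (intro mult_left_mono) auto
    moreover have "norm r \<le> bY * norm q + b2 * norm g + norm g"
      unfolding r_def
      by (intro norm_triangle_le_diff add_mono order_refl norm_triangle_le bY b2)
    ultimately have "norm r \<le> (bY * c + b2 + 1) * norm g" by (simp add: algebra_simps)
    also have "\<dots> \<le> (bY * c + b2 + 1) * (bW * norm v)"
      using ng bY b2 c by (intro mult_left_mono) auto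
    finally have nr: "norm r \<le> (bY * c + b2 + 1) * (bW * norm v)" .
    have "\<bar>v \<bullet> (T *v r)\<bar> \<le> norm v * norm (T *v r)" by (rule Cauchy_Schwarz_ineq2)
    also have "\<dots> \<le> norm v * (bT * norm r)" by (intro mult_left_mono bT) auto
    also have "\<dots> \<le> norm v * (bT * ((bY * c + b2 + 1) * (bW * norm v)))"
      using nr bT by (intro mult_left_mono) auto
    finally have "- (norm v * (bT * ((bY * c + b2 + 1) * (bW * norm v)))) \<le> v \<bullet> (T *v r)" by linarith
    with 1 show ?thesis
      unfolding u k0_def by (simp add: inner_add_right power2_eq_square algebra_simps)
  qed
  \<comment> \<open>\<open>I - K D\<close> will be \<open>L (X + k D)\<close>, so besides
    \<open>k > k0\<close> the gain has to avoid the zeros of this polynomial, which is non-zero at 0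
    because \<open>X\<close> is invertible.\<close>
  define f where "f = (\<lambda>z. det (X + map_matrix ((*) z) D))"
  have "polyfun f"
    unfolding f_def by (intro polyfun_det, simp) (intro polyfun_add polyfun_mult polyfun_const polyfun_id)
  moreover have "map_matrix ((*) 0) D = 0" by (simp add: vec_eq_iff)
  then have "f 0 \<noteq> 0" using X(2) by (simp add: f_def invertible_det_nz)
  ultimately obtain k :: real where k: "k > k0" "f (of_real k) \<noteq> 0" using finite_real_avoid by blast
  define K where "K = - map_matrix ((*) (of_real k)) L"
  have FK: "entries_in F K" unfolding K_def by (intro entries_in_closed[OF F] FL)
  have Kv: "K *v y = - (of_real k *s (L *v y))" for y
    by (simp add: K_def uminus_matrix_vector smult_matrix_vector)
  have LX: "L ** X = mat 1" "X *v (L *v y) = y" for y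
    using X(2) by (simp_all add: L_def inverse_matrix_inv matrix_inv_cancel_vector)
  have "mat 1 - K ** D = L ** (X + map_matrix ((*) (of_real k)) D)"
  proof -
    have "K ** D = - (L ** map_matrix ((*) (of_real k)) D)"
      by (simp add: K_def vec_eq_iff matrix_matrix_mult_def sum_negf mult_ac)
    then show ?thesis by (simp add: matrix_add_ldistrib LX)
  qed
  moreover have "invertible L" using LX(1) matrix_left_right_inverse by (auto simp: invertible_right_inverse)
  moreover have "invertible (X + map_matrix ((*) (of_real k)) D)"
    using k(2) by (simp add: f_def invertible_det_nz)
  ultimately have inv: "invertible (mat 1 - K ** D)" by (simp add: invertible_mult)
  have pos: "0 < (L *v y) \<bullet> (u - K *v y)"
    if s: "- \<epsilon> \<le> Re s" and r: "rosenbrock E A B C D s *v joinv x u = joinv 0 (- y)" and y: "y \<noteq> 0" for s x u y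
  proof -
    \<comment> \<open>In terms of \<open>v\<close> the output is \<open>y = X v\<close>, the
      estimate \<open>lower\<close> applies, and the feedback contributes exactly \<open>k\<close>
      times the squared norm of \<open>v\<close>.\<close>
    define v where "v = L *v y"
    have "v \<noteq> 0" using LX(2)[of y] y by (auto simp: v_def)
    have "- k0 * (norm v)^2 \<le> v \<bullet> u"
      by (rule lower[OF s]) (use r LX(2)[of y] in \<open>simp add: R_def v_def\<close>)
    moreover have "v \<bullet> (u - K *v y) = v \<bullet> u + k * (norm v)^2"
    proof -
      have "v \<bullet> (of_real k *s v) = k * (v \<bullet> v)"
        by (simp add: inner_vec_def inner_complex_def sum_distrib_left algebra_simps)
      then show ?thesis by (simp add: Kv v_def[symmetric] inner_add_right power2_norm_eq_inner)
    qed
    moreover have "k0 * (norm v)^2 < k * (norm v)^2" using k(1) \<open>v \<noteq> 0\<close> by simp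
    ultimately show ?thesis by (simp add: v_def)
  qed
  show thesis
  by (rule that[OF FK FL inv \<epsilon>(1)]) (use Rinv pos in \<open>unfold R_def, blast+\<close>)
qed

text \<open>A kernel vector of the feedback matrix has external input zero, so the strict inequality
  excludes a non-zero output, and the pencil has trivial kernel. For the same reason a non-zero
  external input has a non-zero output, where the inequality is the positivity claimed.\<close>

lemma positive_feedback:
  assumes inv: "invertible (rosenbrock E A B C D s)"
    and pos: "\<And>x u y. rosenbrock E A B C D s *v joinv x u = joinv 0 (- y) \<Longrightarrow> y \<noteq> 0 \<Longrightarrow>
       0 < (L *v y) \<bullet> (u - K *v y)"
  shows "invertible (feedback_matrix E A B C D K s)"
    and "w \<noteq> 0 \<Longrightarrow> 0 < w \<bullet> (L *v (closed_loop E A B C D K s *v w))"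
proof -
  have r: "rosenbrock E A B C D s *v joinv x u = joinv 0 (- (C *v x + D *v u))
      \<and> u - K *v (C *v x + D *v u) = w"
    if "feedback_matrix E A B C D K s *v joinv x u = joinv 0 w" for x u w
    using that unfolding feedback_joinv rosenbrock_joinv joinv_eq_iff by blast
  have zero: "x = 0 \<and> u = 0"
    if "rosenbrock E A B C D s *v joinv x u = joinv 0 (- y)" "y = 0" for x u y
  proof -
    have "rosenbrock E A B C D s *v joinv x u = 0" using that by (simp add: joinv_0)
    then have "joinv x u = 0" using inv invertible_iff_kernel by blast
    then show ?thesis by simp
  qed
  show fb: "invertible (feedback_matrix E A B C D K s)"
    unfolding invertible_iff_kernel
  proof (intro allI impI)
    fix z assume z: "feedback_matrix E A B C D K s *v z = 0"
    obtain x u where xu: "z = joinv x u" by (rule joinv_cases)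
    have *: "rosenbrock E A B C D s *v joinv x u = joinv 0 (- (C *v x + D *v u))
      \<and> u - K *v (C *v x + D *v u) = 0"
      using z by (intro r) (simp add: xu joinv_0)
    then have "C *v x + D *v u = 0"
      using pos[of x u "C *v x + D *v u"] by (metis inner_zero_right less_irrefl)
    then have "x = 0 \<and> u = 0" using zero * by blast
    then show "z = 0" by (simp add: xu)
  qed
  show "0 < w \<bullet> (L *v (closed_loop E A B C D K s *v w))" if w: "w \<noteq> 0"
  proof -
    obtain x u where xu: "matrix_inv (feedback_matrix E A B C D K s) *v joinv 0 w = joinv x u"
      by (rule joinv_cases)
    then have f: "feedback_matrix E A B C D K s *v joinv x u = joinv 0 w"
      using matrix_inv_cancel_vector(1)[OF fb, of "joinv 0 w"] by simp
    define y where "y = C *v x + D *v u"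
    have *: "rosenbrock E A B C D s *v joinv x u = joinv 0 (- y)" "u - K *v y = w"
      using r[OF f] by (simp_all only: y_def)
    have "y \<noteq> 0" using zero[OF *(1)] *(2) w by auto
    from pos[OF *(1) this] show ?thesis
      by (simp add: *(2) closed_loop_vector[OF f fb] y_def[symmetric] inner_commute)
  qed
qed

text \<open>A rational kernel vector takes, at generic points near \<open>a\<close>, non-zero values
  \<open>y\<close> with \<open>y = G K y\<close>. Together with the state driven by
  \<open>K y\<close> this gives a kernel vector of the feedback matrix, which is invertible near
  \<open>a\<close>; so one such point \<open>a\<close> suffices.\<close>

lemma invertible_return_difference:
  fixes E A :: "complex ^ 'n ^ 'n" and B :: "complex ^ 'm ^ 'n" and C :: "complex ^ 'n ^ 'm"
    and D K :: "complex ^ 'm ^ 'm"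
  defines "G \<equiv> transfer_function E A B C D"
  assumes reg: "det (pencil E A) \<noteq> 0" and fb: "invertible (feedback_matrix E A B C D K a)"
  shows "invertible (mat 1 - G ** const_mat K)"
  unfolding invertible_iff_kernel
proof (intro allI impI, rule ccontr)
  fix v assume v: "(mat 1 - G ** const_mat K) *v v = 0" "v \<noteq> 0"
  obtain i where i: "v $ i \<noteq> 0" using v(2) by (auto simp: vec_eq_iff)
  \<comment> \<open>The vector is repeated in every column so that the evaluation rules for matrices
    apply to it.\<close>
  define V :: "complex poly fract ^ 'm ^ 'm" where "V = (\<chi> i j. v $ i)"
  have V0: "(mat 1 - G ** const_mat K) ** V = 0"
    using v(1) by (simp add: vec_eq_iff matrix_matrix_mult_def matrix_vector_mult_def V_def)
  define R where "R = matrix_inv (pencil E A)"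
  have pinv: "invertible (pencil E A)" using reg invertible_det_nz by blast
  have "finite {s. poly (fst (quot_of_fract (v $ i))) s = 0}"
    using i by (intro poly_roots_finite) simp
  then have nz: "\<forall>\<^sub>F s in at a. poly (fst (quot_of_fract (v $ i))) s \<noteq> 0"
    using islimpt_finite[of "{s. poly (fst (quot_of_fract (v $ i))) s = 0}" a]
    by (simp add: islimpt_iff_eventually)
  have "\<forall>\<^sub>F s in at a. False"
    using eventually_mat_regular[of R a] eventually_mat_regular[of V a] nz
      eventually_invertible[OF polyfun_feedback fb]
  proof eventually_elim
    case (elim s)
    define Rs where "Rs = rmat_eval R s"
    define Gs where "Gs = C ** Rs ** B + D"
    define Vs where "Vs = rmat_eval V s"
    have Rs: "(map_matrix ((*) s) E - A) ** Rs = mat 1"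
      using rmat_eval_matrix_inv(1)[OF pinv, of s] elim by (simp add: R_def Rs_def)
    have Gs: "mat_regular_at G s" "rmat_eval G s = Gs"
      using elim by (simp_all add: G_def transfer_function_def Gs_def Rs_def R_def
          rmat_eval_arith rmat_eval_mult)
    have "rmat_eval ((mat 1 - G ** const_mat K) ** V) s = (mat 1 - Gs ** K) ** Vs"
      using Gs elim by (simp add: rmat_eval_arith rmat_eval_mult Vs_def)
    moreover have "rmat_eval (0 :: complex poly fract ^ 'm ^ 'm) s = 0"
      by (simp add: rmat_eval_def vec_eq_iff)
    ultimately have "(mat 1 - Gs ** K) ** Vs = 0" by (simp add: V0)
    then have 0: "(mat 1 - Gs ** K) *v (Vs *v axis i 1) = 0"
      by (simp add: matrix_vector_mul_assoc)
    define y where "y = Vs *v axis i 1"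
    have "y $ i = rat_eval (v $ i) s" by (simp add: y_def mult_axis Vs_def rmat_eval_def V_def)
    moreover have "regular_at (v $ i) s" using elim(2) by (simp add: mat_regular_at_def V_def)
    ultimately have "y $ i \<noteq> 0" using elim(3) by (simp add: rat_eval_def regular_at_def)
    then have "y \<noteq> 0" by auto
    have y: "y = Gs *v (K *v y)"
      using 0 by (simp add: y_def[symmetric] matrix_vector_mult_diff_rdistrib flip: matrix_vector_mul_assoc)
    define x where "x = Rs *v (B *v (K *v y))"
    have "s *s (E *v x) - A *v x = ((map_matrix ((*) s) E - A) ** Rs) *v (B *v (K *v y))"
      by (simp add: x_def matrix_vector_mult_diff_rdistrib smult_matrix_vector flip: matrix_vector_mul_assoc)
    then have e1: "s *s (E *v x) - A *v x - B *v (K *v y) = 0" by (simp add: Rs)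
    have "C *v x + D *v (K *v y) = Gs *v (K *v y)"
      by (simp add: x_def Gs_def matrix_vector_mult_add_rdistrib flip: matrix_vector_mul_assoc)
    then have e2: "C *v x + D *v (K *v y) = y" by (simp flip: y)
    have "feedback_matrix E A B C D K s *v joinv x (K *v y) = 0"
      unfolding feedback_joinv e1 e2 by (simp add: joinv_0)
    then have "joinv x (K *v y) = 0" using elim(4) invertible_iff_kernel by blast
    then have "K *v y = 0" by simp
    then show ?case using y \<open>y \<noteq> 0\<close> by simp
  qed
  then show False by simp
qed

theorem theorem1:
  fixes F :: "complex set"
    and E A :: "complex ^ 'n ^ 'n"
    and B :: "complex ^ 'm ^ 'n"
    and C :: "complex ^ 'n ^ 'm"
    and D :: "complex ^ 'm ^ 'm"
    and G :: "complex poly fract ^ 'm ^ 'm"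
    and \<E> \<A> :: "complex ^ ('n + 'm) ^ ('n + 'm)"
  assumes "F = \<real> \<or> F = UNIV"
    and "entries_in F E" "entries_in F A" "entries_in F B" "entries_in F C" "entries_in F D"
    and "det (pencil E A) \<noteq> 0"
    and "rank (row_block E B) = CARD('n)"
    and "rank (col_block E C) = CARD('n)"
  defines "G \<equiv> transfer_function E A B C D"
    and "\<E> \<equiv> four_block E 0 0 0"
    and "\<A> \<equiv> four_block A B C D"
  shows "(\<exists>K L :: complex ^ 'm ^ 'm.
            entries_in F K \<and> entries_in F L \<and>
            invertible (mat 1 - K ** D) \<and>
            stable_pair E (A + B ** matrix_inv (mat 1 - K ** D) ** K ** C) \<and>
            invertible (mat 1 - G ** const_mat K) \<and>
            SPR (const_mat L ** matrix_inv (mat 1 - G ** const_mat K) ** G))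
     \<longleftrightarrow> (invertible \<A> \<and>
          (\<forall>\<mu>. eigenvalue (matrix_inv \<A> ** \<E>) \<mu> \<and> \<mu> \<noteq> 0 \<longrightarrow> Re \<mu> < 0) \<and>
          index_of_zero (matrix_inv \<A> ** \<E>) \<le> 2)"
    (is "?lhs \<longleftrightarrow> ?rhs")
proof
  assume ?lhs
  then obtain K L :: "complex ^ 'm ^ 'm" where M: "invertible (mat 1 - K ** D)"
    and stable: "stable_pair E (A + B ** matrix_inv (mat 1 - K ** D) ** K ** C)"
    and inv: "invertible (mat 1 - G ** const_mat K)"
    and SPR: "SPR (const_mat L ** matrix_inv (mat 1 - G ** const_mat K) ** G)"
    by blast
  \<comment> \<open>Stability makes the feedback matrix invertible on the closed right half-plane,
    so the SPR function has no poles there and its positivity holds at every such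
    \<open>s\<close>.\<close>
  have fb: "invertible (feedback_matrix E A B C D K s)" if "0 \<le> Re s" for s
    using stable that unfolding feedback_invertible_iff[OF M] stable_pair_def by force
  obtain \<epsilon> where \<epsilon>: "\<epsilon> > 0" "\<And>s. - \<epsilon> \<le> Re s \<Longrightarrow>
      \<not> rmat_pole (const_mat L ** matrix_inv (mat 1 - G ** const_mat K) ** G) s \<Longrightarrow>
      pos_def (rmat_eval (const_mat L ** matrix_inv (mat 1 - G ** const_mat K) ** G) s +
        conj_transpose (rmat_eval (const_mat L ** matrix_inv (mat 1 - G ** const_mat K) ** G) s))"
    using SPR unfolding SPR_def by blast
  have pos: "0 < w \<bullet> (L *v (closed_loop E A B C D K s *v w))" if s: "0 \<le> Re s" and "w \<noteq> 0" for s w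
  proof -
    from closed_loop_transfer[OF assms(7) inv[unfolded G_def] fb[OF s], of L]
    have "pos_def (L ** closed_loop E A B C D K s + conj_transpose (L ** closed_loop E A B C D K s))"
      using \<epsilon>(2)[of s] \<epsilon>(1) s unfolding G_def by simp
    then show ?thesis
      using \<open>w \<noteq> 0\<close> by (simp add: pos_def_hermitian_part matrix_vector_mul_assoc)
  qed
  note nec = necessity[OF assms(8,9) fb pos]
  show ?rhs
    unfolding \<E>_def \<A>_def by (intro conjI allI impI nec) auto
next
  assume ?rhs
  then have rhs: "invertible (four_block A B C D)"
    "\<And>\<mu>. eigenvalue (matrix_inv (four_block A B C D) ** four_block E 0 0 0) \<mu> \<Longrightarrow> \<mu> \<noteq> 0 \<Longrightarrow> Re \<mu> < 0"
    "index_of_zero (matrix_inv (four_block A B C D) ** four_block E 0 0 0) \<le> 2"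
    unfolding \<E>_def \<A>_def by auto
  obtain K L :: "complex ^ 'm ^ 'm" and \<epsilon> where F: "entries_in F K" "entries_in F L" and M: "invertible (mat 1 - K ** D)"
    and \<epsilon>: "\<epsilon> > 0" and inv': "\<forall>s. - \<epsilon> \<le> Re s \<longrightarrow> invertible (rosenbrock E A B C D s)"
    and pos': "\<forall>s x u y. - \<epsilon> \<le> Re s \<and> rosenbrock E A B C D s *v joinv x u = joinv 0 (- y) \<and> y \<noteq> 0 \<longrightarrow>
       0 < (L *v y) \<bullet> (u - K *v y)"
    by (rule sufficiency[OF assms(1-6) rhs])
  have inv: "invertible (rosenbrock E A B C D s)" if "- \<epsilon> \<le> Re s" for s
    using inv' that by simp
  have pos: "0 < (L *v y) \<bullet> (u - K *v y)"
    if "- \<epsilon> \<le> Re s" "rosenbrock E A B C D s *v joinv x u = joinv 0 (- y)" "y \<noteq> 0" for s x u y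
    using pos' that by simp
  have fb: "invertible (feedback_matrix E A B C D K s)" if "- \<epsilon> \<le> Re s" for s
    using positive_feedback(1)[OF inv[OF that] pos[OF that]] .
  have cl: "0 < w \<bullet> (L *v (closed_loop E A B C D K s *v w))" if "- \<epsilon> \<le> Re s" "w \<noteq> 0" for s w
    using positive_feedback(2)[OF inv[OF that(1)] pos[OF that(1)] that(2)] .
  have "stable_pair E (A + B ** matrix_inv (mat 1 - K ** D) ** K ** C)"
    unfolding stable_pair_def
  proof (intro allI impI, rule ccontr)
    fix \<mu> assume ev: "pair_eigenvalue E (A + B ** matrix_inv (mat 1 - K ** D) ** K ** C) \<mu>" "\<not> Re \<mu> < 0"
    then have "- \<epsilon> \<le> Re \<mu>" using \<epsilon> by simp
    from fb[OF this] ev(1) show False by (simp add: feedback_invertible_iff[OF M])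
  qed
  moreover have rd: "invertible (mat 1 - G ** const_mat K)"
    unfolding G_def using \<epsilon> by (intro invertible_return_difference[OF assms(7) fb[of 0]]) simp
  moreover have "SPR (const_mat L ** matrix_inv (mat 1 - G ** const_mat K) ** G)"
    unfolding SPR_def
  proof (intro exI[of _ \<epsilon>] conjI allI impI \<epsilon>)
    fix s assume s: "- \<epsilon> \<le> Re s"
    have "rmat_eval (const_mat L ** matrix_inv (mat 1 - G ** const_mat K) ** G) s
        = L ** closed_loop E A B C D K s"
      using closed_loop_transfer[OF assms(7) rd[unfolded G_def] fb[OF s], of L] by (simp add: G_def)
    then show "pos_def (rmat_eval (const_mat L ** matrix_inv (mat 1 - G ** const_mat K) ** G) s +
        conj_transpose (rmat_eval (const_mat L ** matrix_inv (mat 1 - G ** const_mat K) ** G) s))"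
      using cl[OF s] by (simp add: pos_def_hermitian_part flip: matrix_vector_mul_assoc)
  qed
  ultimately show ?lhs using F M by blast
qed

end
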